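(* Let $R$ be a unital ring, $\Gamma$ a group, and $\mathcal{G}$ a $\Gamma$-graded Hausdorff ample groupoid. Then there is a ring isomorphism \[R\langle\mathsf{S}(\mathcal{G})\rangle\cong R\langle\mathsf{S}^{\mathrm{gr}}(\mathcal{G})\rangle.\]
   Context: Groupoids. A groupoid $\mathcal{G}$ is a small category with all morphisms invertible, identified with its set of morphisms; objects are identified with identity morphisms and form the unit space $\mathcal{G}^{(0)}$. $\mathbf{d}(x)=x^{-1}x$, $\mathbf{r}(x)=xx^{-1}$; $xy$ is defined iff $\mathbf{d}(x)=\mathbf{r}(y)$. A topological groupoid has a topology making inversion and composition continuous; it is étale if $\mathbf{d}:\mathcal{G}\to\mathcal{G}^{(0)}$ is a local homeomorphism. A slice is an open subset on which $\mathbf{d}$ and $\mathbf{r}$ are injective. An étale groupoid is ample if its compact slices form a base for its topology and $\mathcal{G}^{(0)}$ is Hausdorff. $\mathcal{G}$ is $\Gamma$-graded if equipped with a continuous functor $\deg:\mathcal{G}\to\Gamma$ ($\Gamma$ discrete); $\mathcal{G}_\alpha=\deg^{-1}(\alpha)$. $\mathsf{S}(\mathcal{G})$ is the set of all compact slices of $\mathcal{G}$, an inverse semigroup under $XY=\{xy\mid x\in X,y\in Y,\mathbf{d}(x)=\mathbf{r}(y)\}$ and $X^{-1}=\{x^{-1}\mid x\in X\}$, with zero $\emptyset$; its natural partial order is inclusion. $\mathsf{S}^{\mathrm{gr}}(\mathcal{G})$ is the inverse subsemigroup of homogeneous compact slices, i.e. those $X$ with $X\subseteq\mathcal{G}_\alpha$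 for some $\alpha\in\Gamma$; it is $\Gamma$-graded by $\deg(X)=\alpha$ for $\emptyset\ne X\subseteq\mathcal{G}_\alpha$. Enveloping rings. All semigroups have a zero element. A $\Gamma$-grading on a semigroup $S$ is a map $\deg:S\setminus\{0\}\to\Gamma$ with $\deg(st)=\deg(s)\deg(t)$ whenever $st\neq0$; $S_\alpha=\deg^{-1}(\alpha)\cup\{0\}$. In an inverse semigroup, $s\le t$ iff $s=tu$ for some idempotent $u$; joins $\vee$ are with respect to $\le$; $s,t$ are orthogonal if $s^{-1}t=0=st^{-1}$. A $\Gamma$-graded inverse semigroup $S$ is $\Gamma$-graded-Boolean if (1) for all $\alpha\in\Gamma$, every orthogonal pair in $S_\alpha$ has a join in $S$, and (2) the set $E(S)$ of idempotents is a distributive lattice and each nonzero principal order ideal of $E(S)$ is a Boolean algebra. For such $S$, let $R[S]$ be the contracted semigroup ring (the semigroup ring over $R$ with the zero of $S$ identified with the zero of the ring), and set $R\langle S\rangle:=R[S]/I$, where $I$ is the two-sided ideal generated by all $u+v-u\vee v$ with $u,v\in S_\alpha$ orthogonal and $\alpha\in\Gamma$. $\mathsf{S}^{\mathrm{gr}}(\mathcal{G})$ is $\Gamma$-graded-Boolean and $R\langle\mathsf{S}^{\mathrm{gr}}(\mathcal{G})\rangle$ is formed with respect to its $\Gamma$-grading; $\mathsf{S}(\mathcal{G})$ is regarded as trivially graded (all elements in $S_\varepsilon$, $\varepsilon$ the identity of $\Gamma$), so in $R\langle\mathsf{S}(\mathcal{G})\rangle$ the ideal is generated by $u+v-u\vee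 v$ for all orthogonal $u,v\in\mathsf{S}(\mathcal{G})$. *)

theory Defs
  imports "HOL-Analysis.Analysis" "HOL-Algebra.QuotRing"
begin

section \<open>Topological, ample and graded groupoids\<close>

text \<open>A groupoid is identified with its set of arrows, and an object with its identity arrow.
  \<open>gcomp G x y\<close> is meaningful only if \<open>gdom G x = gran G y\<close>.\<close>

record 'g groupoid = "'g partial_object" +
  gcomp :: "'g \<Rightarrow> 'g \<Rightarrow> 'g"
  ginv :: "'g \<Rightarrow> 'g"

definition gdom :: "('g, 'x) groupoid_scheme \<Rightarrow> 'g \<Rightarrow> 'g"
  where "gdom G x = gcomp G (ginv G x) x"

definition gran :: "('g, 'x) groupoid_scheme \<Rightarrow> 'g \<Rightarrow> 'g"
  where "gran G x = gcomp G x (ginv G x)"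

definition unit_space :: "('g, 'x) groupoid_scheme \<Rightarrow> 'g set"
  where "unit_space G = gdom G ` carrier G"

definition composable :: "('g, 'x) groupoid_scheme \<Rightarrow> ('g \<times> 'g) set"
  where "composable G = {(x, y). x \<in> carrier G \<and> y \<in> carrier G \<and> gdom G x = gran G y}"

locale groupoid =
  fixes G :: "('g, 'x) groupoid_scheme"
  assumes ginv_closed: "x \<in> carrier G \<Longrightarrow> ginv G x \<in> carrier G"
    and gdom_ginv: "x \<in> carrier G \<Longrightarrow> gdom G (ginv G x) = gran G x"
    and gran_ginv: "x \<in> carrier G \<Longrightarrow> gran G (ginv G x) = gdom G x"
    and gcomp_closed: "(x, y) \<in> composable G \<Longrightarrow> gcomp G x y \<in> carrier G"
    and gdom_gcomp: "(x, y) \<in> composable G \<Longrightarrow> gdom G (gcomp G x y) = gdom G y"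
    and gran_gcomp: "(x, y) \<in> composable G \<Longrightarrow> gran G (gcomp G x y) = gran G x"
    and gcomp_assoc: "(x, y) \<in> composable G \<Longrightarrow> (y, z) \<in> composable G \<Longrightarrow>
        gcomp G (gcomp G x y) z = gcomp G x (gcomp G y z)"
    and gcomp_gdom: "x \<in> carrier G \<Longrightarrow> gcomp G x (gdom G x) = x"
    and gcomp_gran: "x \<in> carrier G \<Longrightarrow> gcomp G (gran G x) x = x"

locale topological_groupoid = groupoid G
  for G :: "('g, 'x) groupoid_scheme" +
  fixes T :: "'g topology"
  assumes topspace_eq: "topspace T = carrier G"
    and continuous_ginv: "continuous_map T T (ginv G)"
    and continuous_gcomp:
      "continuous_map (subtopology (prod_topology T T) (composable G)) T (\<lambda>(x, y). gcomp G x y)"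

definition local_homeomorphism_map :: "'a topology \<Rightarrow> 'b topology \<Rightarrow> ('a \<Rightarrow> 'b) \<Rightarrow> bool"
  where "local_homeomorphism_map X Y f \<longleftrightarrow>
    f \<in> topspace X \<rightarrow> topspace Y \<and>
    (\<forall>x \<in> topspace X. \<exists>U. openin X U \<and> x \<in> U \<and> openin Y (f ` U) \<and>
      homeomorphic_map (subtopology X U) (subtopology Y (f ` U)) f)"

locale etale_groupoid = topological_groupoid G T
  for G :: "('g, 'x) groupoid_scheme" and T :: "'g topology" +
  assumes local_homeomorphism_gdom:
    "local_homeomorphism_map T (subtopology T (unit_space G)) (gdom G)"

definition slice :: "('g, 'x) groupoid_scheme \<Rightarrow> 'g topology \<Rightarrow> 'g set \<Rightarrow> bool"
  where "slice G T X \<longleftrightarrow> openin T X \<and> inj_on (gdom G) X \<and> inj_on (gran G) X"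

definition compact_slices :: "('g, 'x) groupoid_scheme \<Rightarrow> 'g topology \<Rightarrow> 'g set set"
  where "compact_slices G T = {X. slice G T X \<and> compactin T X}"

locale ample_groupoid = etale_groupoid G T
  for G :: "('g, 'x) groupoid_scheme" and T :: "'g topology" +
  assumes compact_slices_base: "openin T = arbitrary union_of (\<lambda>X. X \<in> compact_slices G T)"
    and Hausdorff_unit_space: "Hausdorff_space (subtopology T (unit_space G))"

definition is_grading ::
    "('g, 'x) groupoid_scheme \<Rightarrow> 'g topology \<Rightarrow> ('a, 'y) monoid_scheme \<Rightarrow> ('g \<Rightarrow> 'a) \<Rightarrow> bool"
  where "is_grading G T \<Gamma> deg \<longleftrightarrow>
    continuous_map T (discrete_topology (carrier \<Gamma>)) deg \<and>
    (\<forall>(x, y) \<in> composable G. deg (gcomp G x y) = deg x \<otimes>\<^bsub>\<Gamma>\<^esub> deg y)"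

definition gcomponent :: "('g, 'x) groupoid_scheme \<Rightarrow> ('g \<Rightarrow> 'a) \<Rightarrow> 'a \<Rightarrow> 'g set"
  where "gcomponent G deg \<alpha> = {x \<in> carrier G. deg x = \<alpha>}"


section \<open>Inverse semigroups with zero\<close>

record 's inv_semigroup = "'s partial_object" +
  smul :: "'s \<Rightarrow> 's \<Rightarrow> 's"
  sinv :: "'s \<Rightarrow> 's"
  szero :: "'s"

definition idempotents :: "('s, 'x) inv_semigroup_scheme \<Rightarrow> 's set"
  where "idempotents S = {u \<in> carrier S. smul S u u = u}"

definition natural_le :: "('s, 'x) inv_semigroup_scheme \<Rightarrow> 's \<Rightarrow> 's \<Rightarrow> bool"
  where "natural_le S s t \<longleftrightarrow> (\<exists>u \<in> idempotents S. s = smul S t u)"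

definition is_join :: "('s, 'x) inv_semigroup_scheme \<Rightarrow> 's \<Rightarrow> 's \<Rightarrow> 's \<Rightarrow> bool"
  where "is_join S s t w \<longleftrightarrow>
    w \<in> carrier S \<and> natural_le S s w \<and> natural_le S t w \<and>
    (\<forall>z \<in> carrier S. natural_le S s z \<and> natural_le S t z \<longrightarrow> natural_le S w z)"

definition orthogonal_pair :: "('s, 'x) inv_semigroup_scheme \<Rightarrow> 's \<Rightarrow> 's \<Rightarrow> bool"
  where "orthogonal_pair S s t \<longleftrightarrow>
    smul S (sinv S s) t = szero S \<and> smul S s (sinv S t) = szero S"

text \<open>A degree map is only relevant on nonzero elements; zero belongs to every component.\<close>

definition scomponent :: "('s, 'x) inv_semigroup_scheme \<Rightarrow> ('s \<Rightarrow> 'a) \<Rightarrow> 'a \<Rightarrow> 's set"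
  where "scomponent S sdeg \<alpha> = {s \<in> carrier S. s \<noteq> szero S \<and> sdeg s = \<alpha>} \<union> {szero S}"


section \<open>Rings without identity\<close>

text \<open>The rings constructed below need not be unital. They are represented by the ring record of
  HOL-Algebra, whose \<open>one\<close> field then carries no information, and ideals and isomorphisms
  are defined without reference to it: the library's \<^const>\<open>ring_iso\<close> would require
  preservation of \<open>one\<close>, and its ideals exist only in unital rings.
  The quotient \<^const>\<open>FactRing\<close> is usable as it stands.\<close>

definition two_sided_ideal :: "'a set \<Rightarrow> ('a, 'x) ring_scheme \<Rightarrow> bool"
  where "two_sided_ideal I A \<longleftrightarrow> additive_subgroup I A \<and>
    (\<forall>a \<in> carrier A. \<forall>i \<in> I. a \<otimes>\<^bsub>A\<^esub> i \<in> I \<and> i \<otimes>\<^bsub>A\<^esub> a \<in> I)"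

definition generated_ideal :: "('a, 'x) ring_scheme \<Rightarrow> 'a set \<Rightarrow> 'a set"
  where "generated_ideal A X = \<Inter>{I. two_sided_ideal I A \<and> X \<subseteq> I}"

definition rng_iso :: "('a, 'x) ring_scheme \<Rightarrow> ('b, 'y) ring_scheme \<Rightarrow> ('a \<Rightarrow> 'b) set"
  where "rng_iso A B = {h. bij_betw h (carrier A) (carrier B) \<and>
    (\<forall>x \<in> carrier A. \<forall>y \<in> carrier A.
      h (x \<oplus>\<^bsub>A\<^esub> y) = h x \<oplus>\<^bsub>B\<^esub> h y \<and> h (x \<otimes>\<^bsub>A\<^esub> y) = h x \<otimes>\<^bsub>B\<^esub> h y)}"

definition is_rng_iso :: "('a, 'x) ring_scheme \<Rightarrow> ('b, 'y) ring_scheme \<Rightarrow> bool"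
  where "is_rng_iso A B \<longleftrightarrow> rng_iso A B \<noteq> {}"


section \<open>Enveloping rings\<close>

text \<open>Elements of the semigroup ring are finitely supported coefficient functions on the
  semigroup, extended by zero to the whole type.\<close>

definition semigroup_ring ::
    "('r, 'y) ring_scheme \<Rightarrow> ('s, 'x) inv_semigroup_scheme \<Rightarrow> ('s \<Rightarrow> 'r) ring"
  where "semigroup_ring R S =
    \<lparr>carrier = {f. (\<forall>s. f s \<in> carrier R) \<and> {s. f s \<noteq> \<zero>\<^bsub>R\<^esub>} \<subseteq> carrier S \<and>
       finite {s. f s \<noteq> \<zero>\<^bsub>R\<^esub>}},
     mult = (\<lambda>f g s. finsum R (\<lambda>(a, b). f a \<otimes>\<^bsub>R\<^esub> g b)
       {(a, b). f a \<noteq> \<zero>\<^bsub>R\<^esub> \<and> g b \<noteq> \<zero>\<^bsub>R\<^esub> \<and> smul S a b = s}),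
     one = undefined,
     zero = (\<lambda>s. \<zero>\<^bsub>R\<^esub>),
     add = (\<lambda>f g s. f s \<oplus>\<^bsub>R\<^esub> g s)\<rparr>"

definition basis_elem :: "('r, 'y) ring_scheme \<Rightarrow> 's \<Rightarrow> 's \<Rightarrow> 'r"
  where "basis_elem R s = (\<lambda>t. if t = s then \<one>\<^bsub>R\<^esub> else \<zero>\<^bsub>R\<^esub>)"

definition zero_ideal ::
    "('r, 'y) ring_scheme \<Rightarrow> ('s, 'x) inv_semigroup_scheme \<Rightarrow> ('s \<Rightarrow> 'r) set"
  where "zero_ideal R S = generated_ideal (semigroup_ring R S) {basis_elem R (szero S)}"

definition contracted_ring ::
    "('r, 'y) ring_scheme \<Rightarrow> ('s, 'x) inv_semigroup_scheme \<Rightarrow> ('s \<Rightarrow> 'r) set ring"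
  where "contracted_ring R S = semigroup_ring R S Quot zero_ideal R S"

definition contracted_elem ::
    "('r, 'y) ring_scheme \<Rightarrow> ('s, 'x) inv_semigroup_scheme \<Rightarrow> 's \<Rightarrow> ('s \<Rightarrow> 'r) set"
  where "contracted_elem R S s = zero_ideal R S +>\<^bsub>semigroup_ring R S\<^esub> basis_elem R s"

definition join_relations ::
    "('r, 'y) ring_scheme \<Rightarrow> ('s, 'x) inv_semigroup_scheme \<Rightarrow> ('a, 'z) monoid_scheme \<Rightarrow>
     ('s \<Rightarrow> 'a) \<Rightarrow> ('s \<Rightarrow> 'r) set set"
  where "join_relations R S \<Gamma> sdeg =
    {contracted_elem R S u \<oplus>\<^bsub>contracted_ring R S\<^esub> contracted_elem R S v
       \<ominus>\<^bsub>contracted_ring R S\<^esub> contracted_elem R S w | u v w.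
     (\<exists>\<alpha> \<in> carrier \<Gamma>. u \<in> scomponent S sdeg \<alpha> \<and> v \<in> scomponent S sdeg \<alpha>) \<and>
     orthogonal_pair S u v \<and> is_join S u v w}"

definition enveloping_ring ::
    "('r, 'y) ring_scheme \<Rightarrow> ('s, 'x) inv_semigroup_scheme \<Rightarrow> ('a, 'z) monoid_scheme \<Rightarrow>
     ('s \<Rightarrow> 'a) \<Rightarrow> ('s \<Rightarrow> 'r) set set ring"
  where "enveloping_ring R S \<Gamma> sdeg =
    contracted_ring R S Quot generated_ideal (contracted_ring R S) (join_relations R S \<Gamma> sdeg)"


section \<open>The semigroups of compact slices\<close>

definition slice_mult :: "('g, 'x) groupoid_scheme \<Rightarrow> 'g set \<Rightarrow> 'g set \<Rightarrow> 'g set"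
  where "slice_mult G X Y = {gcomp G x y | x y. x \<in> X \<and> y \<in> Y \<and> gdom G x = gran G y}"

definition slice_semigroup ::
    "('g, 'x) groupoid_scheme \<Rightarrow> 'g topology \<Rightarrow> 'g set inv_semigroup"
  where "slice_semigroup G T =
    \<lparr>carrier = compact_slices G T, smul = slice_mult G, sinv = (\<lambda>X. ginv G ` X), szero = {}\<rparr>"

definition graded_slice_semigroup ::
    "('g, 'x) groupoid_scheme \<Rightarrow> 'g topology \<Rightarrow> ('a, 'z) monoid_scheme \<Rightarrow> ('g \<Rightarrow> 'a) \<Rightarrow>
     'g set inv_semigroup"
  where "graded_slice_semigroup G T \<Gamma> deg =
    \<lparr>carrier = {X \<in> compact_slices G T. \<exists>\<alpha> \<in> carrier \<Gamma>. X \<subseteq> gcomponent G deg \<alpha>},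
     smul = slice_mult G, sinv = (\<lambda>X. ginv G ` X), szero = {}\<rparr>"

definition slice_degree ::
    "('g, 'x) groupoid_scheme \<Rightarrow> ('a, 'z) monoid_scheme \<Rightarrow> ('g \<Rightarrow> 'a) \<Rightarrow> 'g set \<Rightarrow> 'a"
  where "slice_degree G \<Gamma> deg X = (THE \<alpha>. \<alpha> \<in> carrier \<Gamma> \<and> X \<subseteq> gcomponent G deg \<alpha>)"

end

theory Submission
  imports Defs
begin

text \<open>Since \<open>deg\<close> is continuous, a compact slice \<open>X\<close> meets only finitely many components
  \<open>G\<^sub>\<alpha>\<close>, so it is the orthogonal join of its homogeneous parts \<open>X \<inter> G\<^sub>\<alpha>\<close>. The map sending \<open>X\<close>
  to the sum of the classes of these parts is additive on disjoint unions, because joins of equal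
  degree are sums in the graded ring. It is multiplicative, because \<open>XY\<close> is the disjoint union of the
  products of the parts of \<open>X\<close> and \<open>Y\<close>. Its linear extension therefore factors through the
  ungraded enveloping ring, and the inclusion of homogeneous slices induces the inverse.

  Associativity of the multiplication plays no role in the universal properties involved, so rings
  are replaced by \<open>nonassoc_rng\<close>.\<close>

section \<open>Rings without identity\<close>

text \<open>The enveloping rings are quotients of quotients, so the isomorphism is not built on
  cosets of cosets. Both rings are images of the semigroup ring over all compact slices:
  \<open>QA\<close> under \<open>pA\<close>, and \<open>QB\<close> under the linear extension
  \<open>h\<close> of \<open>homogeneous_sum\<close>. It then suffices that \<open>pA\<close> and
  \<open>h\<close> have the same kernel. One inclusion holds because \<open>h\<close> respects the
  defining relations. For the other, each element is replaced modulo the kernel of \<open>pA\<close>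
  by a combination of homogeneous slices; on these \<open>h\<close> agrees with \<open>pB\<close>,
  and the kernel of \<open>pB\<close> lies in that of \<open>pA\<close>, because orthogonal joins of
  equal degree are also joins among all compact slices. Multiplicativity cannot be checked degree by
  degree, since different pairs of degrees may have the same product. Hence additivity over finite
  disjoint unions comes first, and the products of parts are shown disjoint by injectivity of
  \<open>gdom G\<close> and \<open>gran G\<close>, not by their degrees.\<close>

locale nonassoc_rng = abelian_group A for A (structure) +
  assumes m_closed [intro, simp]: "x \<in> carrier A \<Longrightarrow> y \<in> carrier A \<Longrightarrow> x \<otimes> y \<in> carrier A"
    and l_distr: "x \<in> carrier A \<Longrightarrow> y \<in> carrier A \<Longrightarrow> z \<in> carrier A \<Longrightarrow>
      (x \<oplus> y) \<otimes> z = x \<otimes> z \<oplus> y \<otimes> z"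
    and r_distr: "x \<in> carrier A \<Longrightarrow> y \<in> carrier A \<Longrightarrow> z \<in> carrier A \<Longrightarrow>
      z \<otimes> (x \<oplus> y) = z \<otimes> x \<oplus> z \<otimes> y"
begin

lemma zero_mult [simp]: "x \<in> carrier A \<Longrightarrow> \<zero> \<otimes> x = \<zero>"
  using l_distr[of \<zero> \<zero> x] by simp

lemma mult_zero [simp]: "x \<in> carrier A \<Longrightarrow> x \<otimes> \<zero> = \<zero>"
  using r_distr[of \<zero> \<zero> x] by simp

lemma minus_eq_zero_iff: "x \<in> carrier A \<Longrightarrow> y \<in> carrier A \<Longrightarrow> x \<ominus> y = \<zero> \<longleftrightarrow> x = y"
  unfolding a_minus_def by (metis add.inv_closed minus_equality minus_minus r_neg)

lemma finsum_ldistr: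
  "finite I \<Longrightarrow> f \<in> I \<rightarrow> carrier A \<Longrightarrow> a \<in> carrier A \<Longrightarrow>
    (\<Oplus>i\<in>I. f i) \<otimes> a = (\<Oplus>i\<in>I. f i \<otimes> a)"
  by (induction rule: finite_induct) (auto simp: l_distr Pi_iff)

lemma finsum_rdistr:
  "finite I \<Longrightarrow> f \<in> I \<rightarrow> carrier A \<Longrightarrow> a \<in> carrier A \<Longrightarrow>
    a \<otimes> (\<Oplus>i\<in>I. f i) = (\<Oplus>i\<in>I. a \<otimes> f i)"
  by (induction rule: finite_induct) (auto simp: r_distr Pi_iff)

lemma two_sided_ideal_carrier: "two_sided_ideal (carrier A) A"
  unfolding two_sided_ideal_def
  using add.subgroup_self by (auto intro: additive_subgroupI)

lemma two_sided_ideal_generated_ideal: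
  assumes "X \<subseteq> carrier A"
  shows "two_sided_ideal (generated_ideal A X) A"
proof -
  let ?F = "{I. two_sided_ideal I A \<and> X \<subseteq> I}"
  \<comment> \<open>The intersection of an empty family would be the whole type. The carrier itself
    is a member because it contains \<open>X\<close>.\<close>
  have ne: "?F \<noteq> {}"
    using two_sided_ideal_carrier assms by blast
  have "subgroup (\<Inter>?F) (add_monoid A)"
    by (rule add.subgroups_Inter)
       (use ne in \<open>auto simp: two_sided_ideal_def dest: additive_subgroup.a_subgroup\<close>)
  then show ?thesis
    unfolding two_sided_ideal_def generated_ideal_def
    by (auto intro!: additive_subgroupI simp: two_sided_ideal_def)
qed

end

lemma generated_ideal_superset: "X \<subseteq> generated_ideal A X"
  unfolding generated_ideal_def by blast

lemma generated_ideal_least: "two_sided_ideal K A \<Longrightarrow> X \<subseteq> K \<Longrightarrow> generated_ideal A X \<subseteq> K"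
  unfolding generated_ideal_def by blast

definition rng_hom :: "('a, 'x) ring_scheme \<Rightarrow> ('b, 'y) ring_scheme \<Rightarrow> ('a \<Rightarrow> 'b) set"
  where "rng_hom A B = {h. h \<in> carrier A \<rightarrow> carrier B \<and>
    (\<forall>x \<in> carrier A. \<forall>y \<in> carrier A.
      h (x \<oplus>\<^bsub>A\<^esub> y) = h x \<oplus>\<^bsub>B\<^esub> h y \<and> h (x \<otimes>\<^bsub>A\<^esub> y) = h x \<otimes>\<^bsub>B\<^esub> h y)}"

lemma rng_hom_comp: "h \<in> rng_hom A B \<Longrightarrow> k \<in> rng_hom B C \<Longrightarrow> k \<circ> h \<in> rng_hom A C"
  unfolding rng_hom_def by (auto simp: Pi_iff)

locale nonassoc_rng_hom = A?: nonassoc_rng A + B?: nonassoc_rng B for A (structure) and B (structure) +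
  fixes h
  assumes rng_hom: "h \<in> rng_hom A B"
begin

lemma hom_closed [intro, simp]: "x \<in> carrier A \<Longrightarrow> h x \<in> carrier B"
  using rng_hom by (auto simp: rng_hom_def)

lemma hom_add [simp]: "x \<in> carrier A \<Longrightarrow> y \<in> carrier A \<Longrightarrow> h (x \<oplus>\<^bsub>A\<^esub> y) = h x \<oplus>\<^bsub>B\<^esub> h y"
  using rng_hom by (auto simp: rng_hom_def)

lemma hom_mult [simp]: "x \<in> carrier A \<Longrightarrow> y \<in> carrier A \<Longrightarrow> h (x \<otimes>\<^bsub>A\<^esub> y) = h x \<otimes>\<^bsub>B\<^esub> h y"
  using rng_hom by (auto simp: rng_hom_def)

sublocale abelian_group_hom A B h
  by (intro abelian_group_homI A.abelian_group_axioms B.abelian_group_axioms group_hom.intro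
      group_hom_axioms.intro A.a_group B.a_group) (auto simp: hom_def)

lemma hom_minus: "x \<in> carrier A \<Longrightarrow> y \<in> carrier A \<Longrightarrow> h (x \<ominus>\<^bsub>A\<^esub> y) = h x \<ominus>\<^bsub>B\<^esub> h y"
  by (simp add: a_minus_def)

lemma two_sided_ideal_kernel: "two_sided_ideal {a \<in> carrier A. h a = \<zero>\<^bsub>B\<^esub>} A"
proof -
  have "additive_subgroup {a \<in> carrier A. h a = \<zero>\<^bsub>B\<^esub>} A"
    using additive_subgroup_a_kernel unfolding a_kernel_def' .
  then show ?thesis
    by (simp add: two_sided_ideal_def)
qed

text \<open>Surjectivity turns a factor from \<open>B\<close> into some \<open>h a\<close>, so that
  absorption can be pulled back to \<open>I\<close>.\<close>

lemma two_sided_ideal_image: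
  assumes "two_sided_ideal I A" and "h ` carrier A = carrier B"
  shows "two_sided_ideal (h ` I) B"
proof -
  interpret I: additive_subgroup I A
    using assms by (simp add: two_sided_ideal_def)
  interpret gh: group_hom "add_monoid A" "add_monoid B" h
    by (rule a_group_hom)
  have "additive_subgroup (h ` I) B"
    by (rule additive_subgroupI) (rule gh.subgroup_img_is_subgroup[OF I.a_subgroup])
  moreover have "b \<otimes>\<^bsub>B\<^esub> h i \<in> h ` I \<and> h i \<otimes>\<^bsub>B\<^esub> b \<in> h ` I" if b: "b \<in> carrier B" and i: "i \<in> I" for b i
  proof -
    obtain a where a: "a \<in> carrier A" "b = h a"
      using b assms(2) by auto
    have "a \<otimes>\<^bsub>A\<^esub> i \<in> I" "i \<otimes>\<^bsub>A\<^esub> a \<in> I"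
      using assms(1) a i by (auto simp: two_sided_ideal_def)
    moreover have "b \<otimes>\<^bsub>B\<^esub> h i = h (a \<otimes>\<^bsub>A\<^esub> i)" "h i \<otimes>\<^bsub>B\<^esub> b = h (i \<otimes>\<^bsub>A\<^esub> a)"
      using a i I.a_subset by auto
    ultimately show ?thesis by blast
  qed
  ultimately show ?thesis
    by (auto simp: two_sided_ideal_def)
qed

end

text \<open>Two surjections from one ring with equal kernels identify the same pairs of elements, by
  subtraction. So \<open>g\<close> applied to an arbitrary \<open>f\<close>-preimage does not depend
  on the preimage chosen.\<close>

lemma is_rng_isoI:
  assumes f: "nonassoc_rng_hom A B f" "f ` carrier A = carrier B"
    and g: "nonassoc_rng_hom A C g" "g ` carrier A = carrier C"
    and ker: "\<And>a. a \<in> carrier A \<Longrightarrow> f a = \<zero>\<^bsub>B\<^esub> \<longleftrightarrow> g a = \<zero>\<^bsub>C\<^esub>"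
  shows "is_rng_iso B C"
proof -
  interpret f: nonassoc_rng_hom A B f by fact
  interpret g: nonassoc_rng_hom A C g by fact
  define k where "k b = g (inv_into (carrier A) f b)" for b
  have eq: "f a = f a' \<longleftrightarrow> g a = g a'" if "a \<in> carrier A" "a' \<in> carrier A" for a a'
    using ker[of "a \<ominus>\<^bsub>A\<^esub> a'"] that
    by (simp add: f.hom_minus g.hom_minus f.B.minus_eq_zero_iff g.B.minus_eq_zero_iff)
  have k: "k (f a) = g a" if "a \<in> carrier A" for a
    unfolding k_def using that eq[of "inv_into (carrier A) f (f a)" a]
    by (simp add: f_inv_into_f inv_into_into)
  have "bij_betw k (carrier B) (carrier C)"
    unfolding bij_betw_def inj_on_def f(2)[symmetric] g(2)[symmetric]
    by (auto simp: k eq image_image)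
  moreover have "k (x \<oplus>\<^bsub>B\<^esub> y) = k x \<oplus>\<^bsub>C\<^esub> k y \<and> k (x \<otimes>\<^bsub>B\<^esub> y) = k x \<otimes>\<^bsub>C\<^esub> k y"
    if x: "x \<in> carrier B" and y: "y \<in> carrier B" for x y
  proof -
    obtain a b where "a \<in> carrier A" "x = f a" "b \<in> carrier A" "y = f b"
      using x y f(2) by (metis imageE)
    then show ?thesis
      by (simp add: k flip: f.hom_add f.hom_mult)
  qed
  ultimately have "k \<in> rng_iso B C"
    by (simp add: rng_iso_def)
  then show ?thesis
    by (auto simp: is_rng_iso_def)
qed

section \<open>Quotients by two-sided ideals\<close>

locale rng_ideal = nonassoc_rng A for A (structure) +
  fixes I
  assumes two_sided_ideal: "two_sided_ideal I A"
begin

sublocale abelian_subgroup I A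
  using two_sided_ideal abelian_group_axioms
  by (auto intro!: abelian_subgroupI3 simp: two_sided_ideal_def)

lemma coset_eq_iff: "x \<in> carrier A \<Longrightarrow> y \<in> carrier A \<Longrightarrow> I +> x = I +> y \<longleftrightarrow> x \<ominus> y \<in> I"
  using a_rcos_module[of y x] a_repr_independence'[of x y] a_rcos_self[of x]
  by (auto simp: a_minus_def)

text \<open>\<open>rcoset_mult\<close> is a union of cosets over all pairs of representatives. They
  coincide, since \<open>(i \<oplus> x) \<otimes> (j \<oplus> y)\<close> differs from
  \<open>x \<otimes> y\<close> by \<open>i \<otimes> (j \<oplus> y) \<oplus> x \<otimes> j\<close>,
  which lies in the ideal.\<close>

lemma rcoset_mult_eq:
  assumes "x \<in> carrier A" "y \<in> carrier A"
  shows "rcoset_mult A I (I +> x) (I +> y) = I +> (x \<otimes> y)"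
proof -
  have "I +> (x' \<otimes> y') = I +> (x \<otimes> y)" if x': "x' \<in> I +> x" and y': "y' \<in> I +> y" for x' y'
  proof -
    obtain i j where i: "i \<in> I" "x' = i \<oplus> x" and j: "j \<in> I" "y' = j \<oplus> y"
      using x' y' by (auto simp: a_r_coset_def')
    have c: "i \<in> carrier A" "j \<in> carrier A"
      using i j by auto
    have "x' \<otimes> y' = (i \<otimes> (j \<oplus> y) \<oplus> x \<otimes> j) \<oplus> x \<otimes> y"
      using assms c by (simp add: i j l_distr r_distr a_assoc a_comm a_lcomm)
    moreover have "i \<otimes> (j \<oplus> y) \<oplus> x \<otimes> j \<in> I"
      using two_sided_ideal i j c assms unfolding two_sided_ideal_def
      by (intro a_closed) auto
    ultimately have "x' \<otimes> y' \<in> I +> (x \<otimes> y)"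
      by (auto simp: a_r_coset_def')
    then show ?thesis
      using a_repr_independence'[of _ "x \<otimes> y"] assms by simp
  qed
  \<comment> \<open>Ensures that the union is taken over a nonempty set of representatives.\<close>
  moreover have "x \<in> I +> x" "y \<in> I +> y"
    using assms by (simp_all add: a_rcos_self)
  ultimately show ?thesis
    unfolding rcoset_mult_def by blast
qed

lemma coset_hom: "nonassoc_rng_hom A (A Quot I) (\<lambda>a. I +> a)"
proof -
  interpret Q: abelian_group "A Quot I"
    by (rule comm_group_abelian_groupI)
      (simp add: FactRing_def a_factorgroup_is_comm_group[unfolded A_FactGroup_def'])
  have "nonassoc_rng (A Quot I)"
    by unfold_locales (auto simp: FactRing_simps rcoset_mult_eq a_rcos_sum l_distr r_distr)
  moreover have "(\<lambda>a. I +> a) \<in> rng_hom A (A Quot I)"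
    by (auto simp: rng_hom_def FactRing_simps rcoset_mult_eq a_rcos_sum)
  ultimately show ?thesis
    by (simp add: nonassoc_rng_hom_def nonassoc_rng_axioms nonassoc_rng_hom_axioms_def)
qed

lemma coset_surj: "(\<lambda>a. I +> a) ` carrier A = carrier (A Quot I)"
  by (auto simp: FactRing_simps)

lemma zero_Quot: "\<zero>\<^bsub>A Quot I\<^esub> = I"
  by (simp add: FactRing_def)

lemma coset_eq_zero_iff: "x \<in> carrier A \<Longrightarrow> I +> x = \<zero>\<^bsub>A Quot I\<^esub> \<longleftrightarrow> x \<in> I"
  unfolding zero_Quot using a_rcos_self[of x] a_rcos_const[of x] by auto

end


section \<open>Semigroup rings\<close>

lemma (in abelian_monoid) finsum_eq_addI:
  assumes "f \<in> I \<rightarrow> carrier G" "g \<in> I \<rightarrow> carrier G" "\<And>i. i \<in> I \<Longrightarrow> k i = f i \<oplus> g i"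
  shows "finsum G k I = finsum G f I \<oplus> finsum G g I"
proof -
  have "finsum G k I = (\<Oplus>i\<in>I. f i \<oplus> g i)"
    using assms by (intro finsum_cong') auto
  then show ?thesis
    using assms(1,2) by simp
qed

text \<open>The element \<open>r s\<close> of the semigroup ring. The coefficient is kept because
  these elements generate the ring additively, while the rings here carry no separate scalar
  action.\<close>

definition monomial :: "('r, 'y) ring_scheme \<Rightarrow> 'r \<Rightarrow> 's \<Rightarrow> 's \<Rightarrow> 'r"
  where "monomial R r s = (\<lambda>t. if t = s then r else \<zero>\<^bsub>R\<^esub>)"

lemma basis_elem_eq_monomial: "basis_elem R s = monomial R \<one>\<^bsub>R\<^esub> s"
  by (simp add: basis_elem_def monomial_def)

abbreviation support :: "('r, 'y) ring_scheme \<Rightarrow> ('s \<Rightarrow> 'r) \<Rightarrow> 's set"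
  where "support R f \<equiv> {s. f s \<noteq> \<zero>\<^bsub>R\<^esub>}"

locale semigroup_ring_setup = R: ring R for R (structure) +
  fixes S :: "('s, 'x) inv_semigroup_scheme"
  assumes smul_closed: "s \<in> carrier S \<Longrightarrow> t \<in> carrier S \<Longrightarrow> smul S s t \<in> carrier S"
    and szero_closed: "szero S \<in> carrier S"
    and szero_smul: "s \<in> carrier S \<Longrightarrow> smul S (szero S) s = szero S"
begin

abbreviation RS :: "('s \<Rightarrow> 'a) ring"
  where "RS \<equiv> semigroup_ring R S"

lemma semigroup_ring_carrier:
  "f \<in> carrier RS \<longleftrightarrow> (\<forall>s. f s \<in> carrier R) \<and> support R f \<subseteq> carrier S \<and> finite (support R f)"
  by (simp add: semigroup_ring_def)

lemma semigroup_ring_add: "f \<oplus>\<^bsub>RS\<^esub> g = (\<lambda>s. f s \<oplus> g s)"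
  by (simp add: semigroup_ring_def)

lemma semigroup_ring_zero: "\<zero>\<^bsub>RS\<^esub> = (\<lambda>s. \<zero>)"
  by (simp add: semigroup_ring_def)

text \<open>The defining sum runs over a set that depends on both supports and on \<open>s\<close>.
  A fixed rectangle makes sums for different factors comparable; the added terms are zero.\<close>

lemma semigroup_ring_mult_eq:
  assumes f: "f \<in> carrier RS" and g: "g \<in> carrier RS"
    and F: "finite F" "support R f \<subseteq> F" and H: "finite H" "support R g \<subseteq> H"
  shows "(f \<otimes>\<^bsub>RS\<^esub> g) s =
    (\<Oplus>p\<in>F \<times> H. if smul S (fst p) (snd p) = s then f (fst p) \<otimes> g (snd p) else \<zero>)"
proof -
  have fg: "f t \<in> carrier R" "g t \<in> carrier R" for t
    using f g by (auto simp: semigroup_ring_carrier)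
  have "(f \<otimes>\<^bsub>RS\<^esub> g) s = finsum R (\<lambda>(a, b). f a \<otimes> g b)
       {(a, b). f a \<noteq> \<zero> \<and> g b \<noteq> \<zero> \<and> smul S a b = s}"
    by (simp add: semigroup_ring_def)
  also have "\<dots> = (\<Oplus>p\<in>F \<times> H. if smul S (fst p) (snd p) = s then f (fst p) \<otimes> g (snd p) else \<zero>)"
  proof (rule R.add.finprod_mono_neutral_cong_left)
    show "finite (F \<times> H)" "{(a, b). f a \<noteq> \<zero> \<and> g b \<noteq> \<zero> \<and> smul S a b = s} \<subseteq> F \<times> H"
      using F H by auto
    show "(if smul S (fst p) (snd p) = s then f (fst p) \<otimes> g (snd p) else \<zero>) = \<zero>"
      if "p \<in> F \<times> H - {(a, b). f a \<noteq> \<zero> \<and> g b \<noteq> \<zero> \<and> smul S a b = s}" for p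
      using that fg by (cases p) auto
  qed (use fg in auto)
  finally show ?thesis .
qed

lemma semigroup_ring_mult_support:
  assumes f: "f \<in> carrier RS" and g: "g \<in> carrier RS"
  shows "support R (f \<otimes>\<^bsub>RS\<^esub> g) \<subseteq> (\<lambda>(a, b). smul S a b) ` (support R f \<times> support R g)"
proof
  fix s assume s: "s \<in> support R (f \<otimes>\<^bsub>RS\<^esub> g)"
  show "s \<in> (\<lambda>(a, b). smul S a b) ` (support R f \<times> support R g)"
  proof (rule ccontr)
    assume "\<not> ?thesis"
    then have empty: "{(a, b). f a \<noteq> \<zero> \<and> g b \<noteq> \<zero> \<and> smul S a b = s} = {}"
      by auto
    have "(f \<otimes>\<^bsub>RS\<^esub> g) s = finsum R (\<lambda>(a, b). f a \<otimes> g b)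
        {(a, b). f a \<noteq> \<zero> \<and> g b \<noteq> \<zero> \<and> smul S a b = s}"
      by (simp add: semigroup_ring_def)
    then have "(f \<otimes>\<^bsub>RS\<^esub> g) s = \<zero>"
      unfolding empty by simp
    with s show False by simp
  qed
qed

lemma semigroup_ring_mult_closed:
  assumes f: "f \<in> carrier RS" and g: "g \<in> carrier RS"
  shows "f \<otimes>\<^bsub>RS\<^esub> g \<in> carrier RS"
proof -
  have fin: "finite (support R f \<times> support R g)" and sub: "support R f \<subseteq> carrier S" "support R g \<subseteq> carrier S"
    and c: "f t \<in> carrier R" "g t \<in> carrier R" for t
    using f g by (auto simp: semigroup_ring_carrier)
  have "(f \<otimes>\<^bsub>RS\<^esub> g) s \<in> carrier R" for s
    using f g c by (subst semigroup_ring_mult_eq[OF f g _ order_refl _ order_refl])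
      (auto simp: semigroup_ring_carrier intro!: R.finsum_closed)
  moreover have "support R (f \<otimes>\<^bsub>RS\<^esub> g) \<subseteq> carrier S"
    using semigroup_ring_mult_support[OF f g] sub by (fastforce intro: smul_closed)
  moreover have "finite (support R (f \<otimes>\<^bsub>RS\<^esub> g))"
    by (rule finite_subset[OF semigroup_ring_mult_support[OF f g] finite_imageI[OF fin]])
  ultimately show ?thesis
    by (simp add: semigroup_ring_carrier)
qed

lemma semigroup_ring_add_closed:
  assumes f: "f \<in> carrier RS" and g: "g \<in> carrier RS"
  shows "f \<oplus>\<^bsub>RS\<^esub> g \<in> carrier RS"
proof -
  have "support R (\<lambda>s. f s \<oplus> g s) \<subseteq> support R f \<union> support R g"
    by auto
  moreover have "finite (support R f \<union> support R g)"
    using f g by (simp add: semigroup_ring_carrier)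
  moreover have "support R f \<union> support R g \<subseteq> carrier S" "f s \<in> carrier R" "g s \<in> carrier R" for s
    using f g by (simp_all add: semigroup_ring_carrier)
  ultimately show ?thesis
    unfolding semigroup_ring_carrier semigroup_ring_add
    by (intro conjI allI R.a_closed) (auto elim: finite_subset)
qed

lemma semigroup_ring_abelian_group: "abelian_group RS"
proof (rule abelian_groupI)
  fix f assume f: "f \<in> carrier RS"
  have "support R (\<lambda>s. \<ominus> f s) = support R f"
    using f by (auto simp: semigroup_ring_carrier)
  then show "\<exists>g\<in>carrier RS. g \<oplus>\<^bsub>RS\<^esub> f = \<zero>\<^bsub>RS\<^esub>"
    using f
    by (intro bexI[of _ "\<lambda>s. \<ominus> f s"])
      (auto simp: semigroup_ring_carrier semigroup_ring_add semigroup_ring_zero R.l_neg)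
next
  fix f g assume "f \<in> carrier RS" "g \<in> carrier RS"
  then show "f \<oplus>\<^bsub>RS\<^esub> g \<in> carrier RS"
    by (rule semigroup_ring_add_closed)
next
  fix f g h assume "f \<in> carrier RS" "g \<in> carrier RS" "h \<in> carrier RS"
  then show "f \<oplus>\<^bsub>RS\<^esub> g \<oplus>\<^bsub>RS\<^esub> h = f \<oplus>\<^bsub>RS\<^esub> (g \<oplus>\<^bsub>RS\<^esub> h)"
    by (simp add: semigroup_ring_carrier semigroup_ring_add R.a_assoc)
next
  fix f g assume "f \<in> carrier RS" "g \<in> carrier RS"
  then show "f \<oplus>\<^bsub>RS\<^esub> g = g \<oplus>\<^bsub>RS\<^esub> f"
    by (simp add: semigroup_ring_carrier semigroup_ring_add R.a_comm)
qed (simp_all add: semigroup_ring_carrier semigroup_ring_add semigroup_ring_zero)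

lemma semigroup_ring_mult_add:
  assumes f: "f \<in> carrier RS" and g: "g \<in> carrier RS" and h: "h \<in> carrier RS"
  shows "(f \<oplus>\<^bsub>RS\<^esub> g) \<otimes>\<^bsub>RS\<^esub> h = f \<otimes>\<^bsub>RS\<^esub> h \<oplus>\<^bsub>RS\<^esub> g \<otimes>\<^bsub>RS\<^esub> h"
    and "h \<otimes>\<^bsub>RS\<^esub> (f \<oplus>\<^bsub>RS\<^esub> g) = h \<otimes>\<^bsub>RS\<^esub> f \<oplus>\<^bsub>RS\<^esub> h \<otimes>\<^bsub>RS\<^esub> g"
proof -
  \<comment> \<open>A common index set for \<open>f\<close>, \<open>g\<close> and their sum, whose
    support may shrink by cancellation.\<close>
  define F where "F = support R f \<union> support R g"
  have F: "finite F" "support R f \<subseteq> F" "support R g \<subseteq> F" "support R (f \<oplus>\<^bsub>RS\<^esub> g) \<subseteq> F"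
    using f g by (auto simp: F_def semigroup_ring_carrier semigroup_ring_add)
  have H: "finite (support R h)"
    using h by (simp add: semigroup_ring_carrier)
  have c: "f t \<in> carrier R" "g t \<in> carrier R" "h t \<in> carrier R" for t
    using f g h by (auto simp: semigroup_ring_carrier)
  note fg = semigroup_ring_add_closed[OF f g]
  show "(f \<oplus>\<^bsub>RS\<^esub> g) \<otimes>\<^bsub>RS\<^esub> h = f \<otimes>\<^bsub>RS\<^esub> h \<oplus>\<^bsub>RS\<^esub> g \<otimes>\<^bsub>RS\<^esub> h"
  proof
    fix s
    show "((f \<oplus>\<^bsub>RS\<^esub> g) \<otimes>\<^bsub>RS\<^esub> h) s = (f \<otimes>\<^bsub>RS\<^esub> h \<oplus>\<^bsub>RS\<^esub> g \<otimes>\<^bsub>RS\<^esub> h) s"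
      unfolding semigroup_ring_add[of "f \<otimes>\<^bsub>RS\<^esub> h"]
        semigroup_ring_mult_eq[OF fg h F(1,4) H order_refl] semigroup_ring_mult_eq[OF f h F(1,2) H order_refl]
        semigroup_ring_mult_eq[OF g h F(1,3) H order_refl]
      by (rule R.finsum_eq_addI)
        (auto simp: c semigroup_ring_add R.l_distr)
  qed
  show "h \<otimes>\<^bsub>RS\<^esub> (f \<oplus>\<^bsub>RS\<^esub> g) = h \<otimes>\<^bsub>RS\<^esub> f \<oplus>\<^bsub>RS\<^esub> h \<otimes>\<^bsub>RS\<^esub> g"
  proof
    fix s
    show "(h \<otimes>\<^bsub>RS\<^esub> (f \<oplus>\<^bsub>RS\<^esub> g)) s = (h \<otimes>\<^bsub>RS\<^esub> f \<oplus>\<^bsub>RS\<^esub> h \<otimes>\<^bsub>RS\<^esub> g) s"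
      unfolding semigroup_ring_add[of "h \<otimes>\<^bsub>RS\<^esub> f"]
        semigroup_ring_mult_eq[OF h fg H order_refl F(1,4)] semigroup_ring_mult_eq[OF h f H order_refl F(1,2)]
        semigroup_ring_mult_eq[OF h g H order_refl F(1,3)]
      by (rule R.finsum_eq_addI)
        (auto simp: c semigroup_ring_add R.r_distr)
  qed
qed

sublocale RS: nonassoc_rng RS
  by (intro nonassoc_rng.intro semigroup_ring_abelian_group nonassoc_rng_axioms.intro
      semigroup_ring_mult_closed semigroup_ring_mult_add)

lemma monomial_closed:
  assumes "r \<in> carrier R" "s \<in> carrier S"
  shows "monomial R r s \<in> carrier RS"
proof -
  have "support R (monomial R r s) \<subseteq> {s}"
    by (auto simp: monomial_def)
  then show ?thesis
    using assms finite_subset[of "support R (monomial R r s)" "{s}"]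
    by (auto simp: semigroup_ring_carrier monomial_def)
qed

lemma basis_elem_closed: "s \<in> carrier S \<Longrightarrow> basis_elem R s \<in> carrier RS"
  by (simp add: basis_elem_eq_monomial monomial_closed)

lemma monomial_add:
  "r \<in> carrier R \<Longrightarrow> r' \<in> carrier R \<Longrightarrow>
    monomial R (r \<oplus> r') s = monomial R r s \<oplus>\<^bsub>RS\<^esub> monomial R r' s"
  by (auto simp: monomial_def semigroup_ring_add)

lemma monomial_mult:
  assumes "r \<in> carrier R" "s \<in> carrier S" "r' \<in> carrier R" "s' \<in> carrier S"
  shows "monomial R r s \<otimes>\<^bsub>RS\<^esub> monomial R r' s' = monomial R (r \<otimes> r') (smul S s s')"
proof
  fix t
  have "(monomial R r s \<otimes>\<^bsub>RS\<^esub> monomial R r' s') t = (\<Oplus>p\<in>{s} \<times> {s'}.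
    if smul S (fst p) (snd p) = t then monomial R r s (fst p) \<otimes> monomial R r' s' (snd p) else \<zero>)"
    using assms by (intro semigroup_ring_mult_eq) (auto simp: monomial_closed, auto simp: monomial_def split: if_splits)
  also have "\<dots> = monomial R (r \<otimes> r') (smul S s s') t"
    using assms by (simp add: monomial_def)
  finally show "(monomial R r s \<otimes>\<^bsub>RS\<^esub> monomial R r' s') t = monomial R (r \<otimes> r') (smul S s s') t" .
qed

lemma semigroup_ring_induct [consumes 1, case_names zero monomial add]:
  assumes "f \<in> carrier RS"
    and zero: "P \<zero>\<^bsub>RS\<^esub>"
    and mon: "\<And>r s. r \<in> carrier R \<Longrightarrow> s \<in> carrier S \<Longrightarrow> P (monomial R r s)"
    and add: "\<And>f g. f \<in> carrier RS \<Longrightarrow> g \<in> carrier RS \<Longrightarrow> P f \<Longrightarrow> P g \<Longrightarrow> P (f \<oplus>\<^bsub>RS\<^esub> g)"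
  shows "P f"
proof -
  have "finite F \<Longrightarrow> f \<in> carrier RS \<Longrightarrow> support R f = F \<Longrightarrow> P f" for F f
  proof (induction F arbitrary: f rule: finite_induct)
    case empty
    then have "f = \<zero>\<^bsub>RS\<^esub>"
      by (auto simp: semigroup_ring_zero)
    then show ?case by (simp add: zero)
  next
    case (insert s F)
    define g where "g = f(s := \<zero>)"
    have supp: "support R g = F"
      using insert by (auto simp: g_def)
    have c: "f t \<in> carrier R" for t
      using insert by (auto simp: semigroup_ring_carrier)
    have s: "s \<in> carrier S"
      using insert by (auto simp: semigroup_ring_carrier)
    have g: "g \<in> carrier RS"
      using insert supp by (auto simp: semigroup_ring_carrier g_def)
    have "f = g \<oplus>\<^bsub>RS\<^esub> monomial R (f s) s"
      using c by (auto simp: g_def semigroup_ring_add monomial_def)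
    moreover have "P (g \<oplus>\<^bsub>RS\<^esub> monomial R (f s) s)"
      using insert.IH[OF g supp] g c s by (intro add mon monomial_closed)
    ultimately show ?case by simp
  qed
  then show ?thesis
    using assms(1) by (auto simp: semigroup_ring_carrier)
qed

text \<open>The target \<open>D\<close> has no scalar action, so the coefficient is an argument of
  \<open>\<theta>\<close>, additive in it. Both sides of the product rule are biadditive, so it need
  only be checked on monomials, by induction on each factor.\<close>

lemma linear_extension:
  assumes "nonassoc_rng D"
    and closed: "\<And>r s. r \<in> carrier R \<Longrightarrow> s \<in> carrier S \<Longrightarrow> \<theta> r s \<in> carrier D"
    and add: "\<And>r r' s. r \<in> carrier R \<Longrightarrow> r' \<in> carrier R \<Longrightarrow> s \<in> carrier S \<Longrightarrow>
      \<theta> (r \<oplus> r') s = \<theta> r s \<oplus>\<^bsub>D\<^esub> \<theta> r' s"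
    and mult: "\<And>r r' s s'. r \<in> carrier R \<Longrightarrow> r' \<in> carrier R \<Longrightarrow> s \<in> carrier S \<Longrightarrow> s' \<in> carrier S \<Longrightarrow>
      \<theta> r s \<otimes>\<^bsub>D\<^esub> \<theta> r' s' = \<theta> (r \<otimes> r') (smul S s s')"
  obtains h where "nonassoc_rng_hom RS D h"
    and "\<And>r s. r \<in> carrier R \<Longrightarrow> s \<in> carrier S \<Longrightarrow> h (monomial R r s) = \<theta> r s"
proof -
  interpret D: nonassoc_rng D by fact
  define h where "h f = finsum D (\<lambda>s. \<theta> (f s) s) (support R f)" for f
  have \<theta>0: "\<theta> \<zero> s = \<zero>\<^bsub>D\<^esub>" if "s \<in> carrier S" for s
    using add[of \<zero> \<zero> s] closed[of \<zero> s] that by simp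
  \<comment> \<open>Since \<open>\<theta> \<zero> s\<close> vanishes, the sum may run over any
    larger finite set, which lets two supports be merged.\<close>
  have h_eq: "h f = finsum D (\<lambda>s. \<theta> (f s) s) F"
    if "f \<in> carrier RS" "finite F" "support R f \<subseteq> F" "F \<subseteq> carrier S" for f F
    unfolding h_def
    by (rule D.add.finprod_mono_neutral_cong_left)
      (use that in \<open>auto simp: semigroup_ring_carrier subset_iff intro!: closed \<theta>0\<close>)
  have h_mon: "h (monomial R r s) = \<theta> r s" if "r \<in> carrier R" "s \<in> carrier S" for r s
    using that by (subst h_eq[of _ "{s}"]) (auto simp: monomial_closed closed, auto simp: monomial_def closed split: if_splits)
  have h_closed: "h f \<in> carrier D" if "f \<in> carrier RS" for f
    unfolding h_def using that
    by (intro D.finsum_closed) (auto simp: semigroup_ring_carrier subset_iff intro!: closed)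
  have h_add: "h (f \<oplus>\<^bsub>RS\<^esub> g) = h f \<oplus>\<^bsub>D\<^esub> h g" if f: "f \<in> carrier RS" and g: "g \<in> carrier RS" for f g
  proof -
    define F where "F = support R f \<union> support R g"
    have F: "finite F" "F \<subseteq> carrier S" "support R f \<subseteq> F" "support R g \<subseteq> F" "support R (f \<oplus>\<^bsub>RS\<^esub> g) \<subseteq> F"
      using f g by (auto simp: F_def semigroup_ring_carrier semigroup_ring_add)
    have c: "f t \<in> carrier R" "g t \<in> carrier R" for t
      using f g by (auto simp: semigroup_ring_carrier)
    show ?thesis
      unfolding h_eq[OF f F(1,3,2)] h_eq[OF g F(1,4,2)] h_eq[OF semigroup_ring_add_closed[OF f g] F(1,5,2)]
      by (rule D.finsum_eq_addI)
        (use F(2) c in \<open>auto simp: semigroup_ring_add add closed subset_iff\<close>)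
  qed
  have h0: "h \<zero>\<^bsub>RS\<^esub> = \<zero>\<^bsub>D\<^esub>"
    by (simp add: h_def semigroup_ring_zero)
  have h_mult: "h (f \<otimes>\<^bsub>RS\<^esub> g) = h f \<otimes>\<^bsub>D\<^esub> h g" if f: "f \<in> carrier RS" and g: "g \<in> carrier RS" for f g
    using f
  proof (induction rule: semigroup_ring_induct)
    case zero
    then show ?case using g by (simp add: h0 h_closed)
  next
    case (monomial r s)
    note rs = monomial
    from g show ?case
    proof (induction rule: semigroup_ring_induct)
      case zero
      then show ?case using rs by (simp add: h0 h_closed monomial_closed)
    next
      case (monomial r' s')
      then show ?case using rs by (simp add: monomial_mult h_mon mult smul_closed)
    next
      case (add f g)
      then show ?case using rs by (simp add: RS.r_distr D.r_distr h_add h_closed monomial_closed)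
    qed
  next
    case (add f f')
    then show ?case using g by (simp add: RS.l_distr D.l_distr h_add h_closed)
  qed
  have "nonassoc_rng_hom RS D h"
    using h_closed h_add h_mult RS.nonassoc_rng_axioms D.nonassoc_rng_axioms
    by (auto simp: nonassoc_rng_hom_def nonassoc_rng_hom_axioms_def rng_hom_def)
  with h_mon show thesis by (rule that[rotated])
qed

end


section \<open>The universal property of enveloping rings\<close>

text \<open>The composite of the two quotient maps; it lets elements of the enveloping ring be
  handled through finitely supported functions.\<close>

definition enveloping_map ::
    "('r, 'y) ring_scheme \<Rightarrow> ('s, 'x) inv_semigroup_scheme \<Rightarrow> ('a, 'z) monoid_scheme \<Rightarrow>
     ('s \<Rightarrow> 'a) \<Rightarrow> ('s \<Rightarrow> 'r) \<Rightarrow> ('s \<Rightarrow> 'r) set set"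
  where "enveloping_map R S \<Gamma> sdeg f =
    generated_ideal (contracted_ring R S) (join_relations R S \<Gamma> sdeg)
      +>\<^bsub>contracted_ring R S\<^esub> (zero_ideal R S +>\<^bsub>semigroup_ring R S\<^esub> f)"

text \<open>The index condition of \<open>join_relations\<close>, separated from the coefficient
  ring so that the relations over different semigroups can be compared.\<close>

definition join_triple ::
    "('s, 'x) inv_semigroup_scheme \<Rightarrow> ('a, 'z) monoid_scheme \<Rightarrow> ('s \<Rightarrow> 'a) \<Rightarrow> 's \<Rightarrow> 's \<Rightarrow> 's \<Rightarrow> bool"
  where "join_triple S \<Gamma> sdeg u v w \<longleftrightarrow>
    (\<exists>\<alpha> \<in> carrier \<Gamma>. u \<in> scomponent S sdeg \<alpha> \<and> v \<in> scomponent S sdeg \<alpha>) \<and>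
    orthogonal_pair S u v \<and> is_join S u v w"

context semigroup_ring_setup
begin

lemma join_triple_closed:
  "join_triple S \<Gamma> sdeg u v w \<Longrightarrow> u \<in> carrier S \<and> v \<in> carrier S \<and> w \<in> carrier S"
  using szero_closed by (auto simp: join_triple_def scomponent_def is_join_def)

sublocale Z: rng_ideal RS "zero_ideal R S"
  by unfold_locales
    (auto simp: zero_ideal_def szero_closed intro!: RS.two_sided_ideal_generated_ideal basis_elem_closed)

sublocale C: nonassoc_rng_hom RS "contracted_ring R S" "\<lambda>f. zero_ideal R S +>\<^bsub>RS\<^esub> f"
  unfolding contracted_ring_def by (rule Z.coset_hom)

lemma contracted_elem_closed: "s \<in> carrier S \<Longrightarrow> contracted_elem R S s \<in> carrier (contracted_ring R S)"
  unfolding contracted_elem_def by (simp add: basis_elem_closed)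

lemma join_relations_eq:
  "join_relations R S \<Gamma> sdeg = {contracted_elem R S u \<oplus>\<^bsub>contracted_ring R S\<^esub> contracted_elem R S v
       \<ominus>\<^bsub>contracted_ring R S\<^esub> contracted_elem R S w | u v w. join_triple S \<Gamma> sdeg u v w}"
  unfolding join_relations_def join_triple_def by simp

lemma enveloping_ideal:
  "rng_ideal (contracted_ring R S) (generated_ideal (contracted_ring R S) (join_relations R S \<Gamma> sdeg))"
proof -
  have "join_relations R S \<Gamma> sdeg \<subseteq> carrier (contracted_ring R S)"
    unfolding join_relations_eq
    by (auto dest!: join_triple_closed intro: contracted_elem_closed)
  then show ?thesis
    by (intro rng_ideal.intro rng_ideal_axioms.intro C.B.nonassoc_rng_axioms
        C.B.two_sided_ideal_generated_ideal)
qed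

lemma enveloping_map_hom:
  "nonassoc_rng_hom RS (enveloping_ring R S \<Gamma> sdeg) (enveloping_map R S \<Gamma> sdeg)"
proof -
  let ?J = "generated_ideal (contracted_ring R S) (join_relations R S \<Gamma> sdeg)"
  interpret J: rng_ideal "contracted_ring R S" ?J
    by (rule enveloping_ideal)
  interpret Q: nonassoc_rng_hom "contracted_ring R S" "contracted_ring R S Quot ?J"
      "\<lambda>a. ?J +>\<^bsub>contracted_ring R S\<^esub> a"
    by (rule J.coset_hom)
  show ?thesis
    using rng_hom_comp[OF C.rng_hom Q.rng_hom] RS.nonassoc_rng_axioms Q.B.nonassoc_rng_axioms
    by (simp add: nonassoc_rng_hom_def nonassoc_rng_hom_axioms_def enveloping_ring_def
        enveloping_map_def[abs_def] comp_def)
qed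

lemma enveloping_map_surj:
  "enveloping_map R S \<Gamma> sdeg ` carrier RS = carrier (enveloping_ring R S \<Gamma> sdeg)"
proof -
  let ?J = "generated_ideal (contracted_ring R S) (join_relations R S \<Gamma> sdeg)"
  interpret J: rng_ideal "contracted_ring R S" ?J
    by (rule enveloping_ideal)
  have "enveloping_map R S \<Gamma> sdeg ` carrier RS = (\<lambda>a. ?J +>\<^bsub>contracted_ring R S\<^esub> a) `
      ((\<lambda>f. zero_ideal R S +>\<^bsub>RS\<^esub> f) ` carrier RS)"
    by (simp add: image_image enveloping_map_def[abs_def])
  also have "\<dots> = carrier (enveloping_ring R S \<Gamma> sdeg)"
    using J.coset_surj Z.coset_surj by (simp add: enveloping_ring_def contracted_ring_def)
  finally show ?thesis .
qed

lemma enveloping_map_eq_zero_iff: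
  "f \<in> carrier RS \<Longrightarrow> enveloping_map R S \<Gamma> sdeg f = \<zero>\<^bsub>enveloping_ring R S \<Gamma> sdeg\<^esub> \<longleftrightarrow>
    zero_ideal R S +>\<^bsub>RS\<^esub> f \<in> generated_ideal (contracted_ring R S) (join_relations R S \<Gamma> sdeg)"
  unfolding enveloping_map_def enveloping_ring_def
  by (rule rng_ideal.coset_eq_zero_iff[OF enveloping_ideal]) simp

text \<open>The zero ideal is generated by the zero element with coefficient one. Multiplying this
  generator by \<open>monomial R r (szero S)\<close> yields the coefficient \<open>r\<close>, since
  zero times zero is zero.\<close>

lemma enveloping_map_szero:
  assumes "r \<in> carrier R"
  shows "enveloping_map R S \<Gamma> sdeg (monomial R r (szero S)) = \<zero>\<^bsub>enveloping_ring R S \<Gamma> sdeg\<^esub>"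
proof -
  interpret J: rng_ideal "contracted_ring R S"
      "generated_ideal (contracted_ring R S) (join_relations R S \<Gamma> sdeg)"
    by (rule enveloping_ideal)
  have "basis_elem R (szero S) \<in> zero_ideal R S"
    using generated_ideal_superset[of "{basis_elem R (szero S)}" RS] by (simp add: zero_ideal_def)
  then have "basis_elem R (szero S) \<otimes>\<^bsub>RS\<^esub> monomial R r (szero S) \<in> zero_ideal R S"
    using Z.two_sided_ideal monomial_closed[OF assms szero_closed] by (simp add: two_sided_ideal_def)
  then have "monomial R r (szero S) \<in> zero_ideal R S"
    using assms by (simp add: basis_elem_eq_monomial monomial_mult szero_closed szero_smul)
  then have "zero_ideal R S +>\<^bsub>RS\<^esub> monomial R r (szero S) = \<zero>\<^bsub>contracted_ring R S\<^esub>"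
    using Z.coset_eq_zero_iff monomial_closed[OF assms szero_closed] by (simp add: contracted_ring_def)
  then show ?thesis
    using assms by (simp add: enveloping_map_eq_zero_iff monomial_closed szero_closed)
qed

lemma enveloping_map_join:
  assumes "join_triple S \<Gamma> sdeg u v w"
  shows "enveloping_map R S \<Gamma> sdeg (basis_elem R u) \<oplus>\<^bsub>enveloping_ring R S \<Gamma> sdeg\<^esub>
      enveloping_map R S \<Gamma> sdeg (basis_elem R v) = enveloping_map R S \<Gamma> sdeg (basis_elem R w)"
proof -
  let ?b = "basis_elem R"
  interpret E: nonassoc_rng_hom RS "enveloping_ring R S \<Gamma> sdeg" "enveloping_map R S \<Gamma> sdeg"
    by (rule enveloping_map_hom)
  have c: "?b u \<in> carrier RS" "?b v \<in> carrier RS" "?b w \<in> carrier RS"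
    using join_triple_closed[OF assms] by (auto simp: basis_elem_closed)
  have "zero_ideal R S +>\<^bsub>RS\<^esub> (?b u \<oplus>\<^bsub>RS\<^esub> ?b v \<ominus>\<^bsub>RS\<^esub> ?b w) \<in> join_relations R S \<Gamma> sdeg"
    using assms c by (auto simp: join_relations_eq C.hom_minus contracted_elem_def)
  then have "enveloping_map R S \<Gamma> sdeg (?b u \<oplus>\<^bsub>RS\<^esub> ?b v \<ominus>\<^bsub>RS\<^esub> ?b w) = \<zero>\<^bsub>enveloping_ring R S \<Gamma> sdeg\<^esub>"
    using c generated_ideal_superset[of "join_relations R S \<Gamma> sdeg" "contracted_ring R S"]
    by (simp add: enveloping_map_eq_zero_iff subset_iff)
  then show ?thesis
    using c by (simp add: E.hom_minus E.B.minus_eq_zero_iff)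
qed

text \<open>The defining relations have coefficient one; left multiplication by \<open>r e\<close>, where \<open>e\<close> is a
  local unit, introduces the coefficient \<open>r\<close>.\<close>

lemma enveloping_map_join_monomial:
  assumes uvw: "join_triple S \<Gamma> sdeg u v w" and r: "r \<in> carrier R"
    and e: "e \<in> carrier S" "smul S e u = u" "smul S e v = v" "smul S e w = w"
  shows "enveloping_map R S \<Gamma> sdeg (monomial R r u) \<oplus>\<^bsub>enveloping_ring R S \<Gamma> sdeg\<^esub>
      enveloping_map R S \<Gamma> sdeg (monomial R r v) = enveloping_map R S \<Gamma> sdeg (monomial R r w)"
proof -
  let ?m = "enveloping_map R S \<Gamma> sdeg"
  interpret E: nonassoc_rng_hom RS "enveloping_ring R S \<Gamma> sdeg" ?m
    by (rule enveloping_map_hom)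
  have eq: "?m (monomial R r e) \<otimes>\<^bsub>enveloping_ring R S \<Gamma> sdeg\<^esub> ?m (basis_elem R x) = ?m (monomial R r x)"
    if "x \<in> carrier S" "smul S e x = x" for x
    using that r e by (simp add: monomial_closed basis_elem_eq_monomial monomial_mult flip: E.hom_mult)
  have c: "u \<in> carrier S" "v \<in> carrier S" "w \<in> carrier S"
    using join_triple_closed[OF uvw] by auto
  show ?thesis
    unfolding eq[OF c(1) e(2), symmetric] eq[OF c(2) e(3), symmetric] eq[OF c(3) e(4), symmetric]
      enveloping_map_join[OF uvw, symmetric]
    using c r e by (simp add: E.B.r_distr basis_elem_closed monomial_closed)
qed

text \<open>The kernel \<open>K\<close> of \<open>h\<close> contains the zero ideal, and its image
  in the contracted ring is an ideal containing the join relations. The universal property is stated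
  as a kernel inclusion, so no induced map on the iterated quotient has to be formed.\<close>

lemma enveloping_map_universal:
  assumes "nonassoc_rng_hom RS D h"
    and zero: "h (basis_elem R (szero S)) = \<zero>\<^bsub>D\<^esub>"
    and join: "\<And>u v w. join_triple S \<Gamma> sdeg u v w \<Longrightarrow>
      h (basis_elem R u) \<oplus>\<^bsub>D\<^esub> h (basis_elem R v) = h (basis_elem R w)"
    and f: "f \<in> carrier RS" "enveloping_map R S \<Gamma> sdeg f = \<zero>\<^bsub>enveloping_ring R S \<Gamma> sdeg\<^esub>"
  shows "h f = \<zero>\<^bsub>D\<^esub>"
proof -
  let ?b = "basis_elem R"
  let ?q = "\<lambda>f. zero_ideal R S +>\<^bsub>RS\<^esub> f"
  interpret h: nonassoc_rng_hom RS D h by fact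
  define K where "K = {a \<in> carrier RS. h a = \<zero>\<^bsub>D\<^esub>}"
  have K: "two_sided_ideal K RS"
    unfolding K_def by (rule h.two_sided_ideal_kernel)
  have Z: "zero_ideal R S \<subseteq> K"
    unfolding zero_ideal_def
    by (rule generated_ideal_least[OF K]) (auto simp: K_def zero basis_elem_closed szero_closed)
  have "two_sided_ideal (?q ` K) (contracted_ring R S)"
    using C.two_sided_ideal_image[OF K] Z.coset_surj by (simp add: contracted_ring_def)
  moreover have "join_relations R S \<Gamma> sdeg \<subseteq> ?q ` K"
  proof
    fix x assume "x \<in> join_relations R S \<Gamma> sdeg"
    then obtain u v w where uvw: "join_triple S \<Gamma> sdeg u v w"
      and x: "x = contracted_elem R S u \<oplus>\<^bsub>contracted_ring R S\<^esub> contracted_elem R S v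
       \<ominus>\<^bsub>contracted_ring R S\<^esub> contracted_elem R S w"
      by (auto simp: join_relations_eq)
    have c: "?b u \<in> carrier RS" "?b v \<in> carrier RS" "?b w \<in> carrier RS"
      using join_triple_closed[OF uvw] by (auto simp: basis_elem_closed)
    have "?b u \<oplus>\<^bsub>RS\<^esub> ?b v \<ominus>\<^bsub>RS\<^esub> ?b w \<in> K"
      using c join[OF uvw] by (simp add: K_def h.hom_minus h.B.minus_eq_zero_iff)
    moreover have "x = ?q (?b u \<oplus>\<^bsub>RS\<^esub> ?b v \<ominus>\<^bsub>RS\<^esub> ?b w)"
      using c by (simp add: x contracted_elem_def C.hom_minus)
    ultimately show "x \<in> ?q ` K" by blast
  qed
  ultimately have "generated_ideal (contracted_ring R S) (join_relations R S \<Gamma> sdeg) \<subseteq> ?q ` K"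
    by (rule generated_ideal_least)
  \<comment> \<open>Lying in the image of \<open>K\<close> only gives agreement with some
    \<open>k\<close> modulo the zero ideal; as that ideal is contained in \<open>K\<close>,
    \<open>f\<close> itself lies in \<open>K\<close>.\<close>
  then obtain k where k: "k \<in> K" "?q f = ?q k"
    using f enveloping_map_eq_zero_iff by blast
  then have "f \<ominus>\<^bsub>RS\<^esub> k \<in> K"
    using Z Z.coset_eq_iff[of f k] f by (auto simp: K_def)
  then show ?thesis
    using f k by (simp add: K_def h.hom_minus h.B.minus_eq_zero_iff)
qed

end


section \<open>Compact slices\<close>

context groupoid
begin

lemma composable_iff:
  "(x, y) \<in> composable G \<longleftrightarrow> x \<in> carrier G \<and> y \<in> carrier G \<and> gdom G x = gran G y"
  by (simp add: composable_def)

lemma gdom_closed: "x \<in> carrier G \<Longrightarrow> gdom G x \<in> carrier G"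
  by (metis gdom_def gcomp_closed composable_iff gdom_ginv ginv_closed)

lemma gran_closed: "x \<in> carrier G \<Longrightarrow> gran G x \<in> carrier G"
  by (metis gran_def gcomp_closed composable_iff gran_ginv ginv_closed)

lemma gdom_gdom: "x \<in> carrier G \<Longrightarrow> gdom G (gdom G x) = gdom G x"
  by (metis gdom_def composable_iff gdom_gcomp gdom_ginv ginv_closed)

lemma gran_gdom: "x \<in> carrier G \<Longrightarrow> gran G (gdom G x) = gdom G x"
  by (metis gdom_def composable_iff gran_gcomp gran_ginv gdom_ginv ginv_closed)

lemma gdom_gran: "x \<in> carrier G \<Longrightarrow> gdom G (gran G x) = gran G x"
  by (metis gdom_ginv gdom_gdom ginv_closed)

lemma gran_gran: "x \<in> carrier G \<Longrightarrow> gran G (gran G x) = gran G x"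
  by (metis gdom_ginv gran_gdom ginv_closed)

text \<open>The product of \<open>?z\<close>, \<open>?y\<close> and \<open>x\<close> equals
  \<open>x\<close> in one bracketing and \<open>?z\<close> in the other.\<close>

lemma ginv_ginv:
  assumes x: "x \<in> carrier G"
  shows "ginv G (ginv G x) = x"
proof -
  let ?y = "ginv G x" and ?z = "ginv G (ginv G x)"
  have c: "?y \<in> carrier G" "?z \<in> carrier G"
    using x by (auto intro: ginv_closed)
  have "gcomp G (gcomp G ?z ?y) x = gcomp G ?z (gcomp G ?y x)"
    using x c by (intro gcomp_assoc) (auto simp: composable_iff gdom_ginv)
  moreover have "gcomp G ?z ?y = gran G x"
    using x by (metis gdom_def gdom_ginv)
  moreover have "gcomp G ?y x = gdom G ?z"
    using x c by (metis gdom_def gdom_ginv gran_ginv)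
  ultimately show ?thesis
    using x c by (simp add: gcomp_gran gcomp_gdom)
qed

lemma ginv_gcomp_cancel:
  assumes "(x, y) \<in> composable G"
  shows "gcomp G (ginv G x) (gcomp G x y) = y"
proof -
  have "gcomp G (gcomp G (ginv G x) x) y = gcomp G (ginv G x) (gcomp G x y)"
    using assms by (intro gcomp_assoc) (auto simp: composable_iff gdom_ginv ginv_closed)
  then show ?thesis
    using assms by (metis composable_iff gcomp_gran gdom_def)
qed

lemma gcomp_ginv_cancel:
  assumes "x \<in> carrier G" "g \<in> carrier G" "gran G x = gran G g"
  shows "(x, gcomp G (ginv G x) g) \<in> composable G" and "gcomp G x (gcomp G (ginv G x) g) = g"
proof -
  have c: "(ginv G x, g) \<in> composable G"
    using assms by (simp add: composable_iff ginv_closed gdom_ginv)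
  then show "(x, gcomp G (ginv G x) g) \<in> composable G"
    using assms by (simp add: composable_iff gcomp_closed gran_gcomp gran_ginv)
  show "gcomp G x (gcomp G (ginv G x) g) = g"
    using ginv_gcomp_cancel[OF c] assms by (simp add: ginv_ginv)
qed

text \<open>The second factor is solved for as the inverse of \<open>x\<close> times
  \<open>g\<close>. Membership thus becomes a condition on \<open>g\<close> and \<open>x\<close>
  alone, the form in which openness of the product can be read off.\<close>

lemma slice_mult_iff:
  assumes "X \<subseteq> carrier G" "Y \<subseteq> carrier G"
  shows "g \<in> slice_mult G X Y \<longleftrightarrow>
    g \<in> carrier G \<and> (\<exists>x\<in>X. gran G x = gran G g \<and> gcomp G (ginv G x) g \<in> Y)"
proof
  assume "g \<in> slice_mult G X Y"
  then obtain x y where xy: "x \<in> X" "y \<in> Y" "gdom G x = gran G y" "g = gcomp G x y"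
    by (auto simp: slice_mult_def)
  then have c: "(x, y) \<in> composable G"
    using assms by (auto simp: composable_iff)
  show "g \<in> carrier G \<and> (\<exists>x\<in>X. gran G x = gran G g \<and> gcomp G (ginv G x) g \<in> Y)"
    using xy gcomp_closed[OF c] gran_gcomp[OF c] ginv_gcomp_cancel[OF c] by auto
next
  assume "g \<in> carrier G \<and> (\<exists>x\<in>X. gran G x = gran G g \<and> gcomp G (ginv G x) g \<in> Y)"
  then obtain x where x: "g \<in> carrier G" "x \<in> X" "gran G x = gran G g" "gcomp G (ginv G x) g \<in> Y"
    by blast
  have "x \<in> carrier G"
    using x assms by blast
  from gcomp_ginv_cancel[OF this x(1,3)] x show "g \<in> slice_mult G X Y"
    unfolding slice_mult_def by (force simp: composable_iff)
qed

text \<open>Ranges are units, so they act as a left identity on arrows with those ranges. This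
  supplies the local unit for relations with coefficients.\<close>

lemma slice_mult_gran:
  assumes X: "X \<subseteq> carrier G" and U: "U \<subseteq> carrier G" "gran G ` X \<subseteq> gran G ` U"
  shows "slice_mult G (gran G ` U) X = X"
proof (intro equalityI subsetI)
  fix g assume "g \<in> slice_mult G (gran G ` U) X"
  then obtain u x where ux: "u \<in> U" "x \<in> X" "gdom G (gran G u) = gran G x" "g = gcomp G (gran G u) x"
    by (auto simp: slice_mult_def)
  moreover have "u \<in> carrier G" "x \<in> carrier G"
    using ux U X by auto
  ultimately show "g \<in> X"
    by (metis gdom_gran gcomp_gran)
next
  fix x assume x: "x \<in> X"
  then obtain u where u: "u \<in> U" "gran G x = gran G u"
    using U(2) by auto
  then have "gdom G (gran G u) = gran G x" "x = gcomp G (gran G u) x"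
    using U x X gdom_gran[of u] gcomp_gran[of x] by auto
  with u x show "x \<in> slice_mult G (gran G ` U) X"
    unfolding slice_mult_def by blast
qed

text \<open>This is why inclusion implies the natural partial order.\<close>

lemma slice_mult_gdom_subset:
  assumes "Y \<subseteq> carrier G" "inj_on (gdom G) Y" "X \<subseteq> Y"
  shows "slice_mult G Y (gdom G ` X) = X"
proof (intro equalityI subsetI)
  fix g assume "g \<in> slice_mult G Y (gdom G ` X)"
  then obtain y x where yx: "y \<in> Y" "x \<in> X" "gdom G y = gran G (gdom G x)" "g = gcomp G y (gdom G x)"
    by (auto simp: slice_mult_def)
  then have "gdom G y = gdom G x"
    using assms gran_gdom[of x] by auto
  then have "y = x"
    using yx assms by (auto dest: inj_onD)
  then show "g \<in> X"
    using yx assms gcomp_gdom[of x] by auto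
next
  fix x assume x: "x \<in> X"
  then have "gdom G x = gran G (gdom G x)" "x = gcomp G x (gdom G x)"
    using assms gran_gdom[of x] gcomp_gdom[of x] by auto
  with x assms(3) show "x \<in> slice_mult G Y (gdom G ` X)"
    unfolding slice_mult_def by blast
qed

text \<open>An idempotent slice consists of units: if \<open>u\<close> is a product of
  \<open>x\<close> and \<open>y\<close> from \<open>U\<close>, then \<open>u\<close> has the domain
  of \<open>y\<close> and the range of \<open>x\<close>, so injectivity gives
  \<open>u = x = y\<close>, and an arrow equal to its own square is a unit. Multiplying by units on
  the right only restricts \<open>Y\<close>. Hence the natural order implies inclusion.\<close>

lemma slice_mult_idempotent_subset:
  assumes Y: "Y \<subseteq> carrier G" and U: "U \<subseteq> carrier G" "inj_on (gdom G) U" "inj_on (gran G) U"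
    and idem: "slice_mult G U U = U"
  shows "slice_mult G Y U \<subseteq> Y"
proof
  have unit: "u = gdom G u" if u: "u \<in> U" for u
  proof -
    obtain x y where xy: "x \<in> U" "y \<in> U" "gdom G x = gran G y" "u = gcomp G x y"
      using u idem by (force simp: slice_mult_def)
    then have c: "(x, y) \<in> composable G"
      using U by (auto simp: composable_iff)
    have "u = y" "u = x"
      using xy u U gdom_gcomp[OF c] gran_gcomp[OF c] by (auto dest: inj_onD)
    then have "gcomp G u u = u" "(u, u) \<in> composable G"
      using xy c by auto
    then show ?thesis
      using ginv_gcomp_cancel[of u u] by (simp add: gdom_def)
  qed
  fix g assume "g \<in> slice_mult G Y U"
  then obtain y u where yu: "y \<in> Y" "u \<in> U" "gdom G y = gran G u" "g = gcomp G y u"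
    by (auto simp: slice_mult_def)
  have "u = gdom G y"
    using yu(2,3) unit[OF yu(2)] U gran_gdom[of u] by auto
  then show "g \<in> Y"
    using yu Y gcomp_gdom[of y] by auto
qed

text \<open>The inverse of \<open>x\<close> can be composed with \<open>y\<close> exactly when
  \<open>x\<close> and \<open>y\<close> have the same range, and dually for domains. Orthogonality
  thus becomes a disjointness condition.\<close>

lemma slice_mult_ginv_eq_empty_iff:
  assumes "X \<subseteq> carrier G" "Y \<subseteq> carrier G"
  shows "slice_mult G (ginv G ` X) Y = {} \<longleftrightarrow> gran G ` X \<inter> gran G ` Y = {}"
    and "slice_mult G X (ginv G ` Y) = {} \<longleftrightarrow> gdom G ` X \<inter> gdom G ` Y = {}"
proof -
  have "gdom G (ginv G x) = gran G x" if "x \<in> X" for x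
    using that assms gdom_ginv by blast
  then show "slice_mult G (ginv G ` X) Y = {} \<longleftrightarrow> gran G ` X \<inter> gran G ` Y = {}"
    unfolding slice_mult_def by fastforce
  have "gran G (ginv G y) = gdom G y" if "y \<in> Y" for y
    using that assms gran_ginv by blast
  then show "slice_mult G X (ginv G ` Y) = {} \<longleftrightarrow> gdom G ` X \<inter> gdom G ` Y = {}"
    unfolding slice_mult_def by fastforce
qed

end

section \<open>Continuity of the structure maps, open images and products of compact slices\<close>

context topological_groupoid
begin

lemma continuous_gcomp_compose:
  assumes f: "continuous_map Z T f" and g: "continuous_map Z T g"
    and "\<And>z. z \<in> topspace Z \<Longrightarrow> gdom G (f z) = gran G (g z)"
  shows "continuous_map Z T (\<lambda>z. gcomp G (f z) (g z))"
proof -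
  have "continuous_map Z (subtopology (prod_topology T T) (composable G)) (\<lambda>z. (f z, g z))"
    using assms continuous_map_image_subset_topspace[OF f] continuous_map_image_subset_topspace[OF g]
    by (auto simp: continuous_map_in_subtopology composable_iff topspace_eq continuous_map_paired image_subset_iff)
  from continuous_map_compose[OF this continuous_gcomp] show ?thesis
    by (simp add: comp_def)
qed

lemma continuous_gdom: "continuous_map T T (gdom G)"
proof -
  have "continuous_map T T (\<lambda>x. gcomp G (ginv G x) x)"
    by (rule continuous_gcomp_compose[OF continuous_ginv continuous_map_id[unfolded id_def]])
      (simp add: topspace_eq gdom_ginv)
  then show ?thesis
    by (simp add: gdom_def[abs_def])
qed

lemma continuous_gran: "continuous_map T T (gran G)"
proof -
  have "continuous_map T T (\<lambda>x. gcomp G x (ginv G x))"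
    by (rule continuous_gcomp_compose[OF continuous_map_id[unfolded id_def] continuous_ginv])
      (simp add: topspace_eq gran_ginv)
  then show ?thesis
    by (simp add: gran_def[abs_def])
qed

lemma openin_subset_carrier: "openin T X \<Longrightarrow> X \<subseteq> carrier G"
  using openin_subset topspace_eq by fastforce

lemma compact_slice_subset_carrier: "X \<in> compact_slices G T \<Longrightarrow> X \<subseteq> carrier G"
  by (simp add: compact_slices_def slice_def openin_subset_carrier)

lemma openin_ginv_image:
  assumes "openin T X"
  shows "openin T (ginv G ` X)"
proof -
  have "ginv G ` X = {x \<in> topspace T. ginv G x \<in> X}"
    using openin_subset_carrier[OF assms] ginv_closed ginv_ginv
    unfolding topspace_eq by (force simp: image_iff)
  then show ?thesis
    using openin_continuous_map_preimage[OF continuous_ginv assms] by simp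
qed

end

context etale_groupoid
begin

text \<open>Around a unit take a neighbourhood \<open>U\<close> on which \<open>gdom G\<close> is
  injective. If \<open>x\<close> and \<open>gdom G x\<close> both lie in \<open>U\<close>, they have
  the same domain, so they are equal and \<open>x\<close> is a unit.\<close>

lemma openin_unit_space: "openin T (unit_space G)"
proof (subst openin_subopen, intro ballI)
  fix e assume e: "e \<in> unit_space G"
  then have eG: "e \<in> carrier G" and ee: "gdom G e = e"
    by (auto simp: unit_space_def gdom_closed gdom_gdom)
  then obtain U where U: "openin T U" "e \<in> U"
    and h: "homeomorphic_map (subtopology T U)
      (subtopology (subtopology T (unit_space G)) (gdom G ` U)) (gdom G)"
    using local_homeomorphism_gdom unfolding local_homeomorphism_map_def topspace_eq by blast
  have inj: "inj_on (gdom G) U"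
    using homeomorphic_imp_injective_map[OF h] openin_subset[OF U(1)] by (simp add: inf.absorb2)
  define V where "V = U \<inter> {x \<in> topspace T. gdom G x \<in> U}"
  have "openin T V"
    unfolding V_def using U openin_continuous_map_preimage[OF continuous_gdom] by blast
  moreover have "e \<in> V"
    using U eG ee by (simp add: V_def topspace_eq)
  moreover have "V \<subseteq> unit_space G"
  proof
    fix x assume x: "x \<in> V"
    then have "x \<in> carrier G" "x \<in> U" "gdom G x \<in> U"
      by (auto simp: V_def topspace_eq)
    then have "x = gdom G x"
      using inj gdom_gdom[of x] by (auto dest: inj_onD)
    then show "x \<in> unit_space G"
      using \<open>x \<in> carrier G\<close> by (auto simp: unit_space_def)
  qed
  ultimately show "\<exists>V. openin T V \<and> e \<in> V \<and> V \<subseteq> unit_space G"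
    by blast
qed

text \<open>The local homeomorphism gives openness only relative to the unit space;
  \<open>openin_unit_space\<close> transfers it to \<open>T\<close>.\<close>

lemma openin_gdom_image:
  assumes W: "openin T W"
  shows "openin T (gdom G ` W)"
proof (subst openin_subopen, intro ballI)
  fix y assume "y \<in> gdom G ` W"
  then obtain x where x: "x \<in> W" "y = gdom G x"
    by blast
  then have "x \<in> topspace T"
    using openin_subset[OF W] by blast
  then obtain U where U: "openin T U" "x \<in> U" "openin (subtopology T (unit_space G)) (gdom G ` U)"
    and h: "homeomorphic_map (subtopology T U)
      (subtopology (subtopology T (unit_space G)) (gdom G ` U)) (gdom G)"
    using local_homeomorphism_gdom unfolding local_homeomorphism_map_def by blast
  have "openin (subtopology T U) (U \<inter> W)"
    using W by (simp add: openin_subtopology_Int2)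
  then have "openin (subtopology (subtopology T (unit_space G)) (gdom G ` U)) (gdom G ` (U \<inter> W))"
    using homeomorphic_imp_open_map[OF h] by (simp add: open_map_def)
  then have "openin T (gdom G ` (U \<inter> W))"
    using U(3) openin_unit_space by (metis openin_trans_full)
  then show "\<exists>V. openin T V \<and> y \<in> V \<and> V \<subseteq> gdom G ` W"
    using x U by blast
qed

lemma openin_gran_image:
  assumes W: "openin T W"
  shows "openin T (gran G ` W)"
proof -
  have "gran G ` W = gdom G ` (ginv G ` W)"
    using openin_subset_carrier[OF W] by (force simp: image_image gdom_ginv intro!: image_cong)
  then show ?thesis
    using openin_gdom_image[OF openin_ginv_image[OF W]] by simp
qed

text \<open>On a slice \<open>X\<close> the factor \<open>x\<close> of a product \<open>g\<close> is
  a continuous function of the range of \<open>g\<close>. So the other factor depends continuously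
  on \<open>g\<close>, and the product set is the preimage of \<open>Y\<close> under this
  dependence.\<close>

lemma openin_slice_mult:
  assumes X: "slice G T X" and Y: "openin T Y"
  shows "openin T (slice_mult G X Y)"
proof -
  have oX: "openin T X" and inj: "inj_on (gran G) X"
    using X by (auto simp: slice_def)
  have XG: "X \<subseteq> carrier G" and YG: "Y \<subseteq> carrier G"
    using oX Y by (auto dest: openin_subset_carrier)
  define V where "V = gran G ` X"
  have oV: "openin T V"
    unfolding V_def by (rule openin_gran_image[OF oX])
  have VT: "V \<subseteq> topspace T" and XT: "X \<subseteq> topspace T"
    using openin_subset oV oX by auto
  have "homeomorphic_map (subtopology T X) (subtopology T V) (gran G)"
  proof (rule bijective_open_imp_homeomorphic_map)
    show "continuous_map (subtopology T X) (subtopology T V) (gran G)"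
      using continuous_map_from_subtopology[OF continuous_gran] XT
      by (auto simp: continuous_map_in_subtopology V_def)
    show "open_map (subtopology T X) (subtopology T V) (gran G)"
      unfolding open_map_def
    proof (intro allI impI)
      fix A assume "openin (subtopology T X) A"
      then have "openin T A" "A \<subseteq> X"
        using oX openin_open_subtopology by blast+
      then show "openin (subtopology T V) (gran G ` A)"
        using oV openin_open_subtopology openin_gran_image unfolding V_def by blast
    qed
  qed (use XT VT inj in \<open>auto simp: V_def Int_absorb1\<close>)
  \<comment> \<open>\<open>s\<close> is the section of \<open>gran G\<close> over \<open>V\<close>
    with values in \<open>X\<close>; it recovers the first factor from its range.\<close>
  then obtain s where s: "homeomorphic_maps (subtopology T X) (subtopology T V) (gran G) s"
    by (auto simp: homeomorphic_map_maps)
  have sV: "s v \<in> X" "gran G (s v) = v" if "v \<in> V" for v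
    using s that VT XT continuous_map_image_subset_topspace[of "subtopology T V" "subtopology T X" s]
    by (auto simp: homeomorphic_maps_def Int_absorb1)
  have s_gran: "s (gran G x) = x" if "x \<in> X" for x
    using s that XT by (auto simp: homeomorphic_maps_def)
  define W where "W = {g \<in> topspace T. gran G g \<in> V}"
  have oW: "openin T W"
    unfolding W_def by (rule openin_continuous_map_preimage[OF continuous_gran oV])
  define \<phi> where "\<phi> g = gcomp G (ginv G (s (gran G g))) g" for g
  have "continuous_map (subtopology T W) T \<phi>"
    unfolding \<phi>_def
  proof (rule continuous_gcomp_compose)
    have "continuous_map (subtopology T W) (subtopology T V) (gran G)"
      using continuous_map_from_subtopology[OF continuous_gran]
      by (auto simp: continuous_map_in_subtopology W_def)
    moreover have "continuous_map (subtopology T V) T s"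
      using s by (auto simp: homeomorphic_maps_def continuous_map_in_subtopology)
    ultimately show "continuous_map (subtopology T W) T (\<lambda>g. ginv G (s (gran G g)))"
      using continuous_map_compose[OF continuous_map_compose[of _ _ "gran G" _ s] continuous_ginv]
      by (fastforce simp: comp_def)
    show "continuous_map (subtopology T W) T (\<lambda>g. g)"
      using continuous_map_from_subtopology[OF continuous_map_id] by (simp add: id_def)
    show "gdom G (ginv G (s (gran G g))) = gran G g" if "g \<in> topspace (subtopology T W)" for g
      using that sV[of "gran G g"] XG gdom_ginv by (auto simp: W_def)
  qed
  from openin_continuous_map_preimage[OF this Y] oW
  have "openin T {g \<in> topspace (subtopology T W). \<phi> g \<in> Y}"
    by (metis openin_trans_full)
  moreover have "slice_mult G X Y = {g \<in> topspace (subtopology T W). \<phi> g \<in> Y}"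
  proof (intro equalityI subsetI)
    fix g assume "g \<in> slice_mult G X Y"
    then obtain x where "g \<in> carrier G" "x \<in> X" "gran G x = gran G g" "gcomp G (ginv G x) g \<in> Y"
      using slice_mult_iff[OF XG YG] by blast
    moreover from this have "gran G g \<in> V"
      unfolding V_def by (metis imageI)
    moreover from calculation have "s (gran G g) = x"
      using s_gran[of x] by simp
    ultimately show "g \<in> {g \<in> topspace (subtopology T W). \<phi> g \<in> Y}"
      by (simp add: \<phi>_def W_def topspace_eq)
  next
    fix g assume "g \<in> {g \<in> topspace (subtopology T W). \<phi> g \<in> Y}"
    then have g: "g \<in> carrier G" "gran G g \<in> V" "\<phi> g \<in> Y"
      by (auto simp: W_def topspace_eq)
    then show "g \<in> slice_mult G X Y"
      using slice_mult_iff[OF XG YG] sV[OF g(2)] by (auto simp: \<phi>_def)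
  qed
  ultimately show ?thesis by simp
qed

lemma gdom_image_compact_slice: "X \<in> compact_slices G T \<Longrightarrow> gdom G ` X \<in> compact_slices G T"
  using compact_slice_subset_carrier[of X] openin_gdom_image image_compactin[OF _ continuous_gdom]
  by (auto simp: compact_slices_def slice_def inj_on_def gdom_gdom gran_gdom subset_iff)

lemma gran_image_compact_slice: "X \<in> compact_slices G T \<Longrightarrow> gran G ` X \<in> compact_slices G T"
  using compact_slice_subset_carrier[of X] openin_gran_image image_compactin[OF _ continuous_gran]
  by (auto simp: compact_slices_def slice_def inj_on_def gdom_gran gran_gran subset_iff)

text \<open>In a Hausdorff groupoid the composable pairs form a closed set, so those in the product
  of \<open>X\<close> and \<open>Y\<close> form a compact set, and composition maps it onto the
  product slice.\<close>

lemma slice_mult_compact_slice: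
  assumes "Hausdorff_space T" and X: "X \<in> compact_slices G T" and Y: "Y \<in> compact_slices G T"
  shows "slice_mult G X Y \<in> compact_slices G T"
proof -
  have XG: "X \<subseteq> carrier G" and YG: "Y \<subseteq> carrier G"
    using X Y by (auto dest: compact_slice_subset_carrier)
  have c: "(x, y) \<in> composable G" if "x \<in> X" "y \<in> Y" "gdom G x = gran G y" for x y
    using that XG YG by (auto simp: composable_iff)
  have "closedin (prod_topology T T)
    {p \<in> topspace (prod_topology T T). gdom G (fst p) = gran G (snd p)}"
    using continuous_map_compose[OF continuous_map_fst continuous_gdom]
      continuous_map_compose[OF continuous_map_snd continuous_gran]
    by (intro closedin_continuous_maps_eq[OF assms(1)]) (auto simp: comp_def)
  also have "{p \<in> topspace (prod_topology T T). gdom G (fst p) = gran G (snd p)} = composable G"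
    by (auto simp: composable_def topspace_eq)
  finally have "compactin (prod_topology T T) (composable G \<inter> X \<times> Y)"
    using X Y by (intro closed_Int_compactin) (auto simp: compactin_Times compact_slices_def)
  then have "compactin (subtopology (prod_topology T T) (composable G)) (composable G \<inter> X \<times> Y)"
    by (simp add: compactin_subtopology)
  from image_compactin[OF this continuous_gcomp]
  have "compactin T ((\<lambda>(x, y). gcomp G x y) ` (composable G \<inter> X \<times> Y))" .
  also have "(\<lambda>(x, y). gcomp G x y) ` (composable G \<inter> X \<times> Y) = slice_mult G X Y"
    using c by (force simp: slice_mult_def composable_iff)
  finally have "compactin T (slice_mult G X Y)" .
  moreover have "openin T (slice_mult G X Y)"
    using X Y by (intro openin_slice_mult) (auto simp: compact_slices_def slice_def)
  moreover have "inj_on (gdom G) (slice_mult G X Y) \<and> inj_on (gran G) (slice_mult G X Y)"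
  proof -
    have inj: "inj_on (gdom G) X" "inj_on (gran G) X" "inj_on (gdom G) Y" "inj_on (gran G) Y"
      using X Y by (auto simp: compact_slices_def slice_def)
    have "gcomp G x y = gcomp G x' y'"
      if "x \<in> X" "y \<in> Y" "gdom G x = gran G y" "x' \<in> X" "y' \<in> Y" "gdom G x' = gran G y'"
        and eq: "gdom G (gcomp G x y) = gdom G (gcomp G x' y') \<or> gran G (gcomp G x y) = gran G (gcomp G x' y')"
      for x y x' y'
    proof -
      \<comment> \<open>The domain of a product determines \<open>y\<close>, and then
        \<open>x\<close> through the domain that must match the range of \<open>y\<close>; the range
        determines first \<open>x\<close> and then \<open>y\<close>.\<close>
      have "gdom G y = gdom G y' \<or> gran G x = gran G x'"
        using eq that(1-6) gdom_gcomp[OF c] gran_gcomp[OF c] by metis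
      then show ?thesis
        using that(1-6) inj by (metis inj_onD)
    qed
    then show ?thesis
      unfolding inj_on_def slice_mult_def by blast
  qed
  ultimately show ?thesis
    by (simp add: compact_slices_def slice_def)
qed

lemma empty_compact_slice: "{} \<in> compact_slices G T"
  by (simp add: compact_slices_def slice_def)

text \<open>The ambient slice \<open>X\<close> provides injectivity of \<open>gdom G\<close> and
  \<open>gran G\<close> on the union, which is not automatic for a union of slices.\<close>

lemma Union_compact_slice:
  assumes "finite I" "\<And>i. i \<in> I \<Longrightarrow> Z i \<in> compact_slices G T"
    "(\<Union>i\<in>I. Z i) \<subseteq> X" "X \<in> compact_slices G T"
  shows "(\<Union>i\<in>I. Z i) \<in> compact_slices G T"
proof -
  have "compactin T (\<Union>(Z ` I))" "openin T (\<Union>(Z ` I))"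
    using assms by (auto simp: compact_slices_def slice_def intro!: compactin_Union openin_Union)
  then show ?thesis
    using assms(3,4) by (auto simp: compact_slices_def slice_def intro: inj_on_subset)
qed

lemma orthogonal_Un_compact_slice:
  assumes "X \<in> compact_slices G T" "Y \<in> compact_slices G T"
    and "gran G ` X \<inter> gran G ` Y = {}" "gdom G ` X \<inter> gdom G ` Y = {}"
  shows "X \<union> Y \<in> compact_slices G T"
  using assms
  by (auto simp: compact_slices_def slice_def inj_on_Un compactin_Un)

lemma compact_slice_Int_clopen:
  assumes "X \<in> compact_slices G T" "openin T A" "closedin T A"
  shows "X \<inter> A \<in> compact_slices G T"
  using assms closed_Int_compactin[of T A X]
  by (auto simp: compact_slices_def slice_def Int_commute intro: inj_on_subset)

end


section \<open>Semigroups of compact slices\<close>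

text \<open>Covers the full and the homogeneous slice semigroup at once. Closure under domain images
  supplies the idempotents behind the natural order, closure under range images the local
  units.\<close>

locale slice_subsemigroup = etale_groupoid G T
  for G :: "('g, 'x) groupoid_scheme" and T :: "'g topology" +
  fixes S :: "'g set inv_semigroup"
  assumes smul_eq: "smul S = slice_mult G"
    and sinv_eq: "sinv S = (\<lambda>X. ginv G ` X)"
    and szero_eq: "szero S = {}"
    and carrier_subset: "X \<in> carrier S \<Longrightarrow> X \<in> compact_slices G T"
    and slice_mult_closed: "X \<in> carrier S \<Longrightarrow> Y \<in> carrier S \<Longrightarrow> slice_mult G X Y \<in> carrier S"
    and gdom_image_closed: "X \<in> carrier S \<Longrightarrow> gdom G ` X \<in> carrier S"
    and gran_image_closed: "X \<in> carrier S \<Longrightarrow> gran G ` X \<in> carrier S"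
    and empty_closed: "{} \<in> carrier S"
begin

lemma carrierD:
  assumes "X \<in> carrier S"
  shows "X \<subseteq> carrier G" "inj_on (gdom G) X" "inj_on (gran G) X"
  using carrier_subset[OF assms] compact_slice_subset_carrier
  by (auto simp: compact_slices_def slice_def)

text \<open>If \<open>X\<close> lies in \<open>Y\<close>, the required idempotent is the set of
  domains of \<open>X\<close>: right multiplication by it cuts \<open>Y\<close> down to
  \<open>X\<close>, because \<open>gdom G\<close> is injective on \<open>Y\<close>.\<close>

lemma natural_le_iff:
  assumes X: "X \<in> carrier S" and Y: "Y \<in> carrier S"
  shows "natural_le S X Y \<longleftrightarrow> X \<subseteq> Y"
proof
  assume "natural_le S X Y"
  then obtain U where U: "U \<in> carrier S" "slice_mult G U U = U" "X = slice_mult G Y U"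
    by (auto simp: natural_le_def idempotents_def smul_eq)
  show "X \<subseteq> Y"
    unfolding U(3) by (rule slice_mult_idempotent_subset) (use carrierD Y U in auto)
next
  assume XY: "X \<subseteq> Y"
  have "gdom G x = x" if "x \<in> gdom G ` X" for x
    using that carrierD(1)[OF X] gdom_gdom by auto
  then have "gdom G ` gdom G ` X = id ` gdom G ` X"
    by (intro image_cong) (simp_all only: id_apply)
  then have "gdom G ` gdom G ` X = gdom G ` X"
    by simp
  then have "slice_mult G (gdom G ` X) (gdom G ` X) = gdom G ` X"
    using slice_mult_gdom_subset[of "gdom G ` X" "gdom G ` X"] carrierD[OF gdom_image_closed[OF X]] by simp
  then have "gdom G ` X \<in> idempotents S"
    using gdom_image_closed[OF X] by (simp add: idempotents_def smul_eq)
  moreover have "X = smul S Y (gdom G ` X)"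
    using slice_mult_gdom_subset[OF carrierD(1,2)[OF Y] XY] by (simp add: smul_eq)
  ultimately show "natural_le S X Y"
    unfolding natural_le_def by blast
qed

text \<open>The order is inclusion, so the union is the least upper bound as soon as it belongs to
  the semigroup. For homogeneous slices this is a genuine condition: nonempty slices of different
  degrees have no homogeneous union.\<close>

lemma is_join_iff:
  assumes "X \<in> carrier S" "Y \<in> carrier S" "X \<union> Y \<in> carrier S"
  shows "is_join S X Y W \<longleftrightarrow> W = X \<union> Y"
proof
  assume W: "is_join S X Y W"
  then have "W \<in> carrier S" "X \<subseteq> W" "Y \<subseteq> W"
    using assms natural_le_iff by (auto simp: is_join_def)
  moreover have "natural_le S W (X \<union> Y)"
    using W assms natural_le_iff unfolding is_join_def by (metis Un_upper1 Un_upper2)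
  ultimately show "W = X \<union> Y"
    using natural_le_iff assms(3) by blast
qed (use assms natural_le_iff in \<open>auto simp: is_join_def\<close>)

lemma orthogonal_pair_iff:
  assumes "X \<in> carrier S" "Y \<in> carrier S"
  shows "orthogonal_pair S X Y \<longleftrightarrow>
    gran G ` X \<inter> gran G ` Y = {} \<and> gdom G ` X \<inter> gdom G ` Y = {}"
  using slice_mult_ginv_eq_empty_iff carrierD(1) assms
  by (auto simp: orthogonal_pair_def smul_eq sinv_eq szero_eq)

text \<open>Disjoint pieces of one slice are orthogonal, since \<open>gdom G\<close> and
  \<open>gran G\<close> are injective on their union.\<close>

lemma join_triple_Un:
  assumes X: "X \<in> carrier S" and Y: "Y \<in> carrier S" and XY: "X \<union> Y \<in> carrier S" "X \<inter> Y = {}"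
    and "\<alpha> \<in> carrier \<Gamma>" "X \<in> scomponent S sdeg \<alpha>" "Y \<in> scomponent S sdeg \<alpha>"
  shows "join_triple S \<Gamma> sdeg X Y (X \<union> Y)"
proof -
  have "gran G ` X \<inter> gran G ` Y = {}" "gdom G ` X \<inter> gdom G ` Y = {}"
    using carrierD[OF XY(1)] XY(2) inj_on_image_Int[of "gran G" "X \<union> Y" X Y]
      inj_on_image_Int[of "gdom G" "X \<union> Y" X Y] by simp_all
  then show ?thesis
    using assms by (auto simp: join_triple_def orthogonal_pair_iff is_join_iff)
qed

end

locale slice_semigroup_ring = slice_subsemigroup G T S + R: ring R
  for R :: "('r, 'm) ring_scheme" (structure) and G :: "('g, 'x) groupoid_scheme"
    and T :: "'g topology" and S :: "'g set inv_semigroup"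
begin

sublocale semigroup_ring_setup R S
  by unfold_locales
    (auto simp: smul_eq szero_eq slice_mult_closed empty_closed, auto simp: slice_mult_def)

lemma enveloping_map_empty:
  "r \<in> carrier R \<Longrightarrow> enveloping_map R S \<Gamma> sdeg (monomial R r {}) = \<zero>\<^bsub>enveloping_ring R S \<Gamma> sdeg\<^esub>"
  using enveloping_map_szero by (simp add: szero_eq)

lemma enveloping_map_Un:
  assumes "X \<in> carrier S" "Y \<in> carrier S" and XY: "X \<union> Y \<in> carrier S" and "X \<inter> Y = {}"
    and "\<alpha> \<in> carrier \<Gamma>" "X \<in> scomponent S sdeg \<alpha>" "Y \<in> scomponent S sdeg \<alpha>" and r: "r \<in> carrier R"
  shows "enveloping_map R S \<Gamma> sdeg (monomial R r (X \<union> Y)) =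
    enveloping_map R S \<Gamma> sdeg (monomial R r X) \<oplus>\<^bsub>enveloping_ring R S \<Gamma> sdeg\<^esub>
    enveloping_map R S \<Gamma> sdeg (monomial R r Y)"
proof -
  \<comment> \<open>The ranges of the union serve as a local unit for both pieces and for their
    join.\<close>
  have "slice_mult G (gran G ` (X \<union> Y)) Z = Z" if "Z \<subseteq> X \<union> Y" for Z
    by (rule slice_mult_gran) (use that carrierD(1)[OF XY] in auto)
  then show ?thesis
    using enveloping_map_join_monomial[OF join_triple_Un[OF assms(1-7)] r gran_image_closed[OF XY]]
    by (simp add: smul_eq)
qed

end

section \<open>Graded groupoids and their two slice semigroups\<close>

locale graded_etale_groupoid = etale_groupoid G T + R: ring R + \<Gamma>: group \<Gamma>
  for R :: "('r, 'm) ring_scheme" (structure) and \<Gamma> :: "('a, 'n) monoid_scheme"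
    and G :: "('g, 'x) groupoid_scheme" and T :: "'g topology" +
  fixes deg :: "'g \<Rightarrow> 'a"
  assumes Hausdorff: "Hausdorff_space T"
    and grading: "is_grading G T \<Gamma> deg"
begin

abbreviation "SA \<equiv> slice_semigroup G T"
abbreviation "SB \<equiv> graded_slice_semigroup G T \<Gamma> deg"
abbreviation "QA \<equiv> enveloping_ring R SA \<Gamma> (\<lambda>_. \<one>\<^bsub>\<Gamma>\<^esub>)"
abbreviation "QB \<equiv> enveloping_ring R SB \<Gamma> (slice_degree G \<Gamma> deg)"
abbreviation "pA \<equiv> enveloping_map R SA \<Gamma> (\<lambda>_. \<one>\<^bsub>\<Gamma>\<^esub>)"
abbreviation "pB \<equiv> enveloping_map R SB \<Gamma> (slice_degree G \<Gamma> deg)"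
abbreviation "hcomp \<alpha> \<equiv> gcomponent G deg \<alpha>"

lemma deg_closed: "x \<in> carrier G \<Longrightarrow> deg x \<in> carrier \<Gamma>"
  using grading by (auto simp: is_grading_def continuous_map_def topspace_eq)

lemma deg_gcomp: "(x, y) \<in> composable G \<Longrightarrow> deg (gcomp G x y) = deg x \<otimes>\<^bsub>\<Gamma>\<^esub> deg y"
  using grading by (auto simp: is_grading_def)

lemma deg_gdom: "x \<in> carrier G \<Longrightarrow> deg (gdom G x) = \<one>\<^bsub>\<Gamma>\<^esub>"
  using deg_gcomp[of x "gdom G x"] gcomp_gdom[of x] deg_closed[of x] deg_closed[of "gdom G x"]
  by (simp add: composable_iff gdom_closed gran_gdom)

lemma deg_gran: "x \<in> carrier G \<Longrightarrow> deg (gran G x) = \<one>\<^bsub>\<Gamma>\<^esub>"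
  using deg_gdom[OF gran_closed, of x] gdom_gran[of x] by simp

lemma compact_slice_Int_hcomp:
  assumes "X \<in> compact_slices G T"
  shows "X \<inter> hcomp \<alpha> \<in> compact_slices G T"
proof (rule compact_slice_Int_clopen[OF assms])
  have c: "continuous_map T (discrete_topology (carrier \<Gamma>)) deg"
    using grading by (simp add: is_grading_def)
  \<comment> \<open>Intersecting with the carrier keeps the set inside the discrete space even when
    \<open>\<alpha>\<close> is not a group element; the component is then empty.\<close>
  have "hcomp \<alpha> = {x \<in> topspace T. deg x \<in> {\<alpha>} \<inter> carrier \<Gamma>}"
    using deg_closed by (auto simp: gcomponent_def topspace_eq)
  then show "openin T (hcomp \<alpha>)" "closedin T (hcomp \<alpha>)"
    using openin_continuous_map_preimage[OF c, of "{\<alpha>} \<inter> carrier \<Gamma>"]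
      closedin_continuous_map_preimage[OF c, of "{\<alpha>} \<inter> carrier \<Gamma>"] by auto
qed

lemma finite_deg_image:
  assumes "X \<in> compact_slices G T"
  shows "finite (deg ` X)"
proof -
  have "compactin (discrete_topology (carrier \<Gamma>)) (deg ` X)"
    using assms grading by (intro image_compactin[of T]) (auto simp: compact_slices_def is_grading_def)
  then show ?thesis
    by (simp add: compactin_discrete_topology)
qed

lemma carrier_SA: "carrier SA = compact_slices G T"
  by (simp add: slice_semigroup_def)

lemma carrier_SB: "X \<in> carrier SB \<longleftrightarrow> X \<in> compact_slices G T \<and> (\<exists>\<alpha> \<in> carrier \<Gamma>. X \<subseteq> hcomp \<alpha>)"
  by (simp add: graded_slice_semigroup_def)

sublocale A: slice_semigroup_ring R G T SA
  by unfold_locales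
    (auto simp: slice_semigroup_def slice_mult_compact_slice[OF Hausdorff] gdom_image_compact_slice
      gran_image_compact_slice empty_compact_slice)

lemma slice_mult_hcomp_subset:
  "X \<subseteq> hcomp \<alpha> \<Longrightarrow> Y \<subseteq> hcomp \<beta> \<Longrightarrow> slice_mult G X Y \<subseteq> hcomp (\<alpha> \<otimes>\<^bsub>\<Gamma>\<^esub> \<beta>)"
  using deg_gcomp gcomp_closed
  by (fastforce simp: slice_mult_def gcomponent_def composable_iff subset_iff)

sublocale B: slice_semigroup_ring R G T SB
proof unfold_locales
  fix X Y assume "X \<in> carrier SB" "Y \<in> carrier SB"
  then show "slice_mult G X Y \<in> carrier SB"
    using slice_mult_hcomp_subset slice_mult_compact_slice[OF Hausdorff]
    by (meson \<Gamma>.m_closed carrier_SB)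
next
  fix X assume X: "X \<in> carrier SB"
  then have "X \<subseteq> carrier G"
    by (auto simp: carrier_SB dest: compact_slice_subset_carrier)
  then have "gdom G ` X \<subseteq> hcomp \<one>\<^bsub>\<Gamma>\<^esub>" "gran G ` X \<subseteq> hcomp \<one>\<^bsub>\<Gamma>\<^esub>"
    by (auto simp: gcomponent_def deg_gdom deg_gran gdom_closed gran_closed)
  then show "gdom G ` X \<in> carrier SB" "gran G ` X \<in> carrier SB"
    using X gdom_image_compact_slice gran_image_compact_slice unfolding carrier_SB by blast+
next
  show "{} \<in> carrier SB"
    using empty_compact_slice \<Gamma>.one_closed unfolding carrier_SB by blast
qed (auto simp: graded_slice_semigroup_def)

sublocale pA: nonassoc_rng_hom A.RS QA pA
  by (rule A.enveloping_map_hom)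

sublocale pB: nonassoc_rng_hom B.RS QB pB
  by (rule B.enveloping_map_hom)

lemma scomponent_SA: "scomponent SA (\<lambda>_. \<one>\<^bsub>\<Gamma>\<^esub>) \<one>\<^bsub>\<Gamma>\<^esub> = compact_slices G T"
  using empty_compact_slice by (auto simp: scomponent_def slice_semigroup_def)

text \<open>The description in \<open>slice_degree\<close> is unique only for nonempty slices, any
  element of which fixes the degree. The empty slice belongs to every component as the zero.\<close>

lemma scomponent_SB:
  assumes "\<alpha> \<in> carrier \<Gamma>"
  shows "scomponent SB (slice_degree G \<Gamma> deg) \<alpha> = {X \<in> compact_slices G T. X \<subseteq> hcomp \<alpha>}"
proof -
  have eq: "slice_degree G \<Gamma> deg X = \<beta>" if "X \<noteq> {}" "\<beta> \<in> carrier \<Gamma>" "X \<subseteq> hcomp \<beta>" for X \<beta>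
    unfolding slice_degree_def
  proof (rule the_equality)
    fix \<gamma> assume "\<gamma> \<in> carrier \<Gamma> \<and> X \<subseteq> hcomp \<gamma>"
    with that show "\<gamma> = \<beta>"
      by (auto simp: gcomponent_def)
  qed (use that in simp)
  have "szero SB = {}"
    by (simp add: graded_slice_semigroup_def)
  then show ?thesis
    using eq assms empty_compact_slice unfolding scomponent_def
    by (auto simp: carrier_SB)
qed

lemma Int_hcomp_closed: "X \<in> compact_slices G T \<Longrightarrow> X \<inter> hcomp \<alpha> \<in> carrier SB"
proof (cases "\<alpha> \<in> carrier \<Gamma>")
  case False
  then have "hcomp \<alpha> = {}"
    using deg_closed by (auto simp: gcomponent_def)
  then show ?thesis
    by (simp add: B.empty_closed)
qed (auto simp: carrier_SB intro: compact_slice_Int_hcomp)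

section \<open>The sum of the homogeneous parts of a slice\<close>

lemma pB_closed: "r \<in> carrier R \<Longrightarrow> X \<in> carrier SB \<Longrightarrow> pB (monomial R r X) \<in> carrier QB"
  by (simp add: B.monomial_closed)

definition homogeneous_sum :: "'r \<Rightarrow> 'g set \<Rightarrow> ('g set \<Rightarrow> 'r) set set"
  where "homogeneous_sum r X = finsum QB (\<lambda>\<alpha>. pB (monomial R r (X \<inter> hcomp \<alpha>))) (deg ` X)"

text \<open>Degrees outside the image of \<open>X\<close> give empty parts, whose classes vanish.
  Sums for several slices can therefore be taken over one index set.\<close>

lemma homogeneous_sum_eq:
  assumes r: "r \<in> carrier R" and X: "X \<in> compact_slices G T" and D: "finite D" "deg ` X \<subseteq> D"
  shows "homogeneous_sum r X = finsum QB (\<lambda>\<alpha>. pB (monomial R r (X \<inter> hcomp \<alpha>))) D"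
  unfolding homogeneous_sum_def
proof (rule pB.B.add.finprod_mono_neutral_cong_left[OF D])
  fix \<alpha> assume "\<alpha> \<in> D - deg ` X"
  then have "X \<inter> hcomp \<alpha> = {}"
    by (auto simp: gcomponent_def)
  then show "pB (monomial R r (X \<inter> hcomp \<alpha>)) = \<zero>\<^bsub>QB\<^esub>"
    using B.enveloping_map_empty[OF r] by simp
qed (use r X in \<open>auto intro!: pB_closed Int_hcomp_closed\<close>)

lemma homogeneous_sum_closed:
  "r \<in> carrier R \<Longrightarrow> X \<in> compact_slices G T \<Longrightarrow> homogeneous_sum r X \<in> carrier QB"
  unfolding homogeneous_sum_def by (auto intro!: pB.B.finsum_closed pB_closed Int_hcomp_closed)

lemma homogeneous_sum_homogeneous:
  assumes r: "r \<in> carrier R" and X: "X \<in> carrier SB"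
  shows "homogeneous_sum r X = pB (monomial R r X)"
proof -
  obtain \<alpha> where \<alpha>: "X \<in> compact_slices G T" "X \<subseteq> hcomp \<alpha>"
    using X by (auto simp: carrier_SB)
  then have "X \<inter> hcomp \<alpha> = X" "deg ` X \<subseteq> {\<alpha>}"
    by (auto simp: gcomponent_def)
  then show ?thesis
    using homogeneous_sum_eq[OF r \<alpha>(1), of "{\<alpha>}"] pB_closed[OF r X] by simp
qed

text \<open>In each fixed degree the parts of \<open>X\<close> and \<open>Y\<close> are disjoint
  pieces of the corresponding part of the union, so the graded join relation applies
  termwise.\<close>

lemma homogeneous_sum_Un:
  assumes r: "r \<in> carrier R" and X: "X \<in> compact_slices G T" and Y: "Y \<in> compact_slices G T"
    and XY: "X \<union> Y \<in> compact_slices G T" "X \<inter> Y = {}"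
  shows "homogeneous_sum r (X \<union> Y) = homogeneous_sum r X \<oplus>\<^bsub>QB\<^esub> homogeneous_sum r Y"
proof -
  define D where "D = deg ` (X \<union> Y)"
  have D: "finite D" "deg ` X \<subseteq> D" "deg ` Y \<subseteq> D" "deg ` (X \<union> Y) \<subseteq> D" "D \<subseteq> carrier \<Gamma>"
    using finite_deg_image[OF XY(1)] compact_slice_subset_carrier[OF XY(1)] deg_closed
    by (auto simp: D_def)
  show ?thesis
    unfolding homogeneous_sum_eq[OF r X D(1,2)] homogeneous_sum_eq[OF r Y D(1,3)]
      homogeneous_sum_eq[OF r XY(1) D(1,4)]
  proof (rule pB.B.finsum_eq_addI)
    fix \<alpha> assume "\<alpha> \<in> D"
    then have \<alpha>: "\<alpha> \<in> carrier \<Gamma>"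
      using D by blast
    have "X \<inter> hcomp \<alpha> \<union> Y \<inter> hcomp \<alpha> \<in> carrier SB"
      using Int_hcomp_closed[OF XY(1)] by (simp add: Int_Un_distrib2)
    then have "pB (monomial R r (X \<inter> hcomp \<alpha> \<union> Y \<inter> hcomp \<alpha>)) =
        pB (monomial R r (X \<inter> hcomp \<alpha>)) \<oplus>\<^bsub>QB\<^esub> pB (monomial R r (Y \<inter> hcomp \<alpha>))"
      using X Y XY \<alpha> r
      by (intro B.enveloping_map_Un[OF _ _ _ _ \<alpha>])
        (auto simp: scomponent_SB Int_hcomp_closed compact_slice_Int_hcomp)
    then show "pB (monomial R r ((X \<union> Y) \<inter> hcomp \<alpha>)) =
        pB (monomial R r (X \<inter> hcomp \<alpha>)) \<oplus>\<^bsub>QB\<^esub> pB (monomial R r (Y \<inter> hcomp \<alpha>))"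
      by (simp add: Int_Un_distrib2)
  qed (use r X Y in \<open>auto intro!: pB_closed Int_hcomp_closed\<close>)
qed

lemma homogeneous_sum_UNION:
  assumes r: "r \<in> carrier R" and "finite I" and "\<And>i. i \<in> I \<Longrightarrow> Z i \<in> compact_slices G T"
    and "(\<Union>i\<in>I. Z i) \<in> compact_slices G T" and "disjoint_family_on Z I"
  shows "homogeneous_sum r (\<Union>i\<in>I. Z i) = finsum QB (\<lambda>i. homogeneous_sum r (Z i)) I"
  using assms(2-)
proof (induction I rule: finite_induct)
  case empty
  then show ?case by (simp add: homogeneous_sum_def)
next
  case (insert j I)
  have Z: "Z i \<in> compact_slices G T" if "i \<in> insert j I" for i
    using insert.prems(1) that by blast
  \<comment> \<open>Partial unions are slices because they sit inside the full union.\<close>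
  have U: "(\<Union>i\<in>I. Z i) \<in> compact_slices G T"
    by (rule Union_compact_slice[OF insert.hyps(1) _ _ insert.prems(2)]) (use Z in auto)
  have "disjoint_family_on Z I"
    using insert.prems(3) by (rule disjoint_family_on_mono[rotated]) auto
  then have IH: "homogeneous_sum r (\<Union>i\<in>I. Z i) = finsum QB (\<lambda>i. homogeneous_sum r (Z i)) I"
    using insert.IH Z U by simp
  have "Z j \<inter> (\<Union>i\<in>I. Z i) = {}"
    using insert.hyps(2) insert.prems(3) by (auto simp: disjoint_family_on_def)
  then have "homogeneous_sum r (Z j \<union> (\<Union>i\<in>I. Z i)) =
      homogeneous_sum r (Z j) \<oplus>\<^bsub>QB\<^esub> homogeneous_sum r (\<Union>i\<in>I. Z i)"
    using homogeneous_sum_Un[OF r Z U] insert.prems(2) by simp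
  also have "\<dots> = finsum QB (\<lambda>i. homogeneous_sum r (Z i)) (insert j I)"
    unfolding IH by (subst pB.B.finsum_insert) (use insert.hyps Z r homogeneous_sum_closed in auto)
  finally show ?case by simp
qed

lemma compact_slice_eq_UNION_hcomp:
  assumes "X \<in> compact_slices G T"
  shows "X = (\<Union>\<alpha>\<in>deg ` X. X \<inter> hcomp \<alpha>)" and "disjoint_family_on (\<lambda>\<alpha>. X \<inter> hcomp \<alpha>) I"
  using compact_slice_subset_carrier[OF assms]
  by (auto simp: gcomponent_def disjoint_family_on_def)

text \<open>Each product of two parts is homogeneous, so its class is its own
  \<open>homogeneous_sum\<close>. The double sum is then reassembled by additivity over disjoint
  unions, first over the parts of \<open>Y\<close> and then over those of \<open>X\<close>; products
  of equal degree need no regrouping.\<close>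

lemma homogeneous_sum_mult:
  assumes r: "r \<in> carrier R" and r': "r' \<in> carrier R"
    and X: "X \<in> compact_slices G T" and Y: "Y \<in> compact_slices G T"
  shows "homogeneous_sum r X \<otimes>\<^bsub>QB\<^esub> homogeneous_sum r' Y =
    homogeneous_sum (r \<otimes> r') (slice_mult G X Y)"
proof -
  have XG: "X \<subseteq> carrier G" and YG: "Y \<subseteq> carrier G"
    using X Y by (auto dest: compact_slice_subset_carrier)
  have inj: "inj_on (gran G) X" "inj_on (gdom G) Y"
    using X Y by (auto simp: compact_slices_def slice_def)
  note fin = finite_deg_image[OF X] finite_deg_image[OF Y]
  note mult_closed = slice_mult_compact_slice[OF Hausdorff]
  define x y where "x \<alpha> = pB (monomial R r (X \<inter> hcomp \<alpha>))" and "y \<beta> = pB (monomial R r' (Y \<inter> hcomp \<beta>))" for \<alpha> \<beta>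
  have xy: "x \<alpha> \<in> carrier QB" "y \<alpha> \<in> carrier QB" for \<alpha>
    using r r' X Y by (auto simp: x_def y_def intro!: pB_closed Int_hcomp_closed)
  have prod: "x \<alpha> \<otimes>\<^bsub>QB\<^esub> y \<beta> = homogeneous_sum (r \<otimes> r') (slice_mult G (X \<inter> hcomp \<alpha>) (Y \<inter> hcomp \<beta>))" for \<alpha> \<beta>
  proof -
    have "x \<alpha> \<otimes>\<^bsub>QB\<^esub> y \<beta> = pB (monomial R (r \<otimes> r') (slice_mult G (X \<inter> hcomp \<alpha>) (Y \<inter> hcomp \<beta>)))"
      using r r' X Y by (simp add: x_def y_def B.monomial_mult B.monomial_closed Int_hcomp_closed B.smul_eq
          flip: pB.hom_mult)
    also have "\<dots> = homogeneous_sum (r \<otimes> r') (slice_mult G (X \<inter> hcomp \<alpha>) (Y \<inter> hcomp \<beta>))"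
      using r r' X Y
      by (intro homogeneous_sum_homogeneous[symmetric]) (auto intro: B.slice_mult_closed Int_hcomp_closed)
    finally show ?thesis .
  qed
  have row: "(\<Union>\<beta>\<in>deg ` Y. slice_mult G (X \<inter> hcomp \<alpha>) (Y \<inter> hcomp \<beta>)) = slice_mult G (X \<inter> hcomp \<alpha>) Y" for \<alpha>
    using compact_slice_eq_UNION_hcomp(1)[OF Y] unfolding slice_mult_def by blast
  have col: "(\<Union>\<alpha>\<in>deg ` X. slice_mult G (X \<inter> hcomp \<alpha>) Y) = slice_mult G X Y"
    using compact_slice_eq_UNION_hcomp(1)[OF X] unfolding slice_mult_def by blast
  \<comment> \<open>A product has the domain of its second factor, which determines that factor in
    \<open>Y\<close> and hence its degree.\<close>
  have disj_row: "disjoint_family_on (\<lambda>\<beta>. slice_mult G (X \<inter> hcomp \<alpha>) (Y \<inter> hcomp \<beta>)) (deg ` Y)" for \<alpha>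
  proof -
    have "\<beta> = \<beta>'" if "g \<in> slice_mult G (X \<inter> hcomp \<alpha>) (Y \<inter> hcomp \<beta>)"
      and "g \<in> slice_mult G (X \<inter> hcomp \<alpha>) (Y \<inter> hcomp \<beta>')" for g \<beta> \<beta>'
    proof -
      have *: "\<exists>y\<in>Y. gdom G y = gdom G g \<and> deg y = \<gamma>"
        if g: "g \<in> slice_mult G (X \<inter> hcomp \<alpha>) (Y \<inter> hcomp \<gamma>)" for \<gamma>
        using g XG YG gdom_gcomp by (fastforce simp: slice_mult_def composable_iff gcomponent_def)
      show ?thesis
        using *[OF that(1)] *[OF that(2)] inj(2) by (metis inj_onD)
    qed
    then show ?thesis
      unfolding disjoint_family_on_def by blast
  qed
  \<comment> \<open>Dually, the range of a product determines its first factor in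
    \<open>X\<close>.\<close>
  have disj_col: "disjoint_family_on (\<lambda>\<alpha>. slice_mult G (X \<inter> hcomp \<alpha>) Y) (deg ` X)"
  proof -
    have "\<alpha> = \<alpha>'" if "g \<in> slice_mult G (X \<inter> hcomp \<alpha>) Y" "g \<in> slice_mult G (X \<inter> hcomp \<alpha>') Y" for g \<alpha> \<alpha>'
    proof -
      have *: "\<exists>x\<in>X. gran G x = gran G g \<and> deg x = \<gamma>" if g: "g \<in> slice_mult G (X \<inter> hcomp \<gamma>) Y" for \<gamma>
        using g XG YG gran_gcomp by (fastforce simp: slice_mult_def composable_iff gcomponent_def)
      show ?thesis
        using *[OF that(1)] *[OF that(2)] inj(1) by (metis inj_onD)
    qed
    then show ?thesis
      unfolding disjoint_family_on_def by blast
  qed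
  have "homogeneous_sum r X \<otimes>\<^bsub>QB\<^esub> homogeneous_sum r' Y =
      finsum QB (\<lambda>\<alpha>. x \<alpha> \<otimes>\<^bsub>QB\<^esub> homogeneous_sum r' Y) (deg ` X)"
    unfolding homogeneous_sum_def[of r X] x_def[symmetric]
    using fin xy homogeneous_sum_closed[OF r' Y] by (intro pB.B.finsum_ldistr) auto
  also have "\<dots> = finsum QB (\<lambda>\<alpha>. homogeneous_sum (r \<otimes> r') (slice_mult G (X \<inter> hcomp \<alpha>) Y)) (deg ` X)"
  proof (rule pB.B.finsum_cong')
    fix \<alpha> assume "\<alpha> \<in> deg ` X"
    have "x \<alpha> \<otimes>\<^bsub>QB\<^esub> homogeneous_sum r' Y = finsum QB (\<lambda>\<beta>. x \<alpha> \<otimes>\<^bsub>QB\<^esub> y \<beta>) (deg ` Y)"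
      unfolding homogeneous_sum_def[of r' Y] y_def[symmetric]
      using fin xy by (intro pB.B.finsum_rdistr) auto
    also have "\<dots> = homogeneous_sum (r \<otimes> r') (\<Union>\<beta>\<in>deg ` Y. slice_mult G (X \<inter> hcomp \<alpha>) (Y \<inter> hcomp \<beta>))"
      unfolding prod
      by (rule homogeneous_sum_UNION[symmetric])
        (use r r' X Y fin row disj_row in \<open>auto intro!: mult_closed compact_slice_Int_hcomp\<close>)
    finally show "x \<alpha> \<otimes>\<^bsub>QB\<^esub> homogeneous_sum r' Y =
        homogeneous_sum (r \<otimes> r') (slice_mult G (X \<inter> hcomp \<alpha>) Y)"
      unfolding row .
  qed (use r r' X Y in \<open>auto intro!: homogeneous_sum_closed mult_closed compact_slice_Int_hcomp\<close>)
  also have "\<dots> = homogeneous_sum (r \<otimes> r') (\<Union>\<alpha>\<in>deg ` X. slice_mult G (X \<inter> hcomp \<alpha>) Y)"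
    by (rule homogeneous_sum_UNION[symmetric])
      (use r r' X Y fin col disj_col in \<open>auto intro!: mult_closed compact_slice_Int_hcomp\<close>)
  finally show ?thesis
    unfolding col .
qed

lemma homogeneous_sum_add:
  assumes r: "r \<in> carrier R" and r': "r' \<in> carrier R" and X: "X \<in> compact_slices G T"
  shows "homogeneous_sum (r \<oplus> r') X = homogeneous_sum r X \<oplus>\<^bsub>QB\<^esub> homogeneous_sum r' X"
  unfolding homogeneous_sum_def
  by (rule pB.B.finsum_eq_addI)
    (use assms in \<open>auto intro!: pB_closed Int_hcomp_closed simp: B.monomial_add B.monomial_closed Int_hcomp_closed\<close>)

section \<open>Joins in the two slice semigroups\<close>

lemma join_triple_SA:
  assumes "join_triple SA \<Gamma> (\<lambda>_. \<one>\<^bsub>\<Gamma>\<^esub>) u v w"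
  shows "u \<in> compact_slices G T" "v \<in> compact_slices G T" "u \<union> v \<in> compact_slices G T"
    "u \<inter> v = {}" "w = u \<union> v"
proof -
  show c: "u \<in> compact_slices G T" "v \<in> compact_slices G T"
    using A.join_triple_closed[OF assms] by (auto simp: carrier_SA)
  have "orthogonal_pair SA u v"
    using assms by (simp add: join_triple_def)
  then have orth: "gran G ` u \<inter> gran G ` v = {}" "gdom G ` u \<inter> gdom G ` v = {}"
    using A.orthogonal_pair_iff c by (auto simp: carrier_SA)
  then show un: "u \<union> v \<in> compact_slices G T" and "u \<inter> v = {}"
    using orthogonal_Un_compact_slice[OF c] by auto
  show "w = u \<union> v"
    using assms A.is_join_iff c un by (auto simp: join_triple_def carrier_SA)
qed

text \<open>A join in the smaller semigroup need not in general be one in the larger. Here the equal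
  degrees make the union homogeneous, so both semigroups have this union as the join.\<close>

lemma join_triple_SB:
  assumes "join_triple SB \<Gamma> (slice_degree G \<Gamma> deg) u v w"
  shows "join_triple SA \<Gamma> (\<lambda>_. \<one>\<^bsub>\<Gamma>\<^esub>) u v w"
proof -
  obtain \<alpha> where \<alpha>: "\<alpha> \<in> carrier \<Gamma>" "u \<in> scomponent SB (slice_degree G \<Gamma> deg) \<alpha>"
      "v \<in> scomponent SB (slice_degree G \<Gamma> deg) \<alpha>" and orth: "orthogonal_pair SB u v"
    and join: "is_join SB u v w"
    using assms by (auto simp: join_triple_def)
  then have c: "u \<in> compact_slices G T" "v \<in> compact_slices G T" "u \<subseteq> hcomp \<alpha>" "v \<subseteq> hcomp \<alpha>"
    by (auto simp: scomponent_SB)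
  have uv: "u \<in> carrier SB" "v \<in> carrier SB"
    using c \<alpha>(1) unfolding carrier_SB by blast+
  have orth: "gran G ` u \<inter> gran G ` v = {}" "gdom G ` u \<inter> gdom G ` v = {}"
    using orth B.orthogonal_pair_iff[OF uv] by simp_all
  then have un: "u \<union> v \<in> compact_slices G T" and disj: "u \<inter> v = {}"
    using orthogonal_Un_compact_slice[OF c(1,2)] by auto
  have "u \<union> v \<in> carrier SB"
    using c un \<alpha>(1) unfolding carrier_SB by blast
  then have "w = u \<union> v"
    using B.is_join_iff[OF uv] join by blast
  then show ?thesis
    using A.join_triple_Un[OF _ _ _ disj \<Gamma>.one_closed] c un by (simp add: carrier_SA scomponent_SA)
qed

section \<open>Homogeneous elements inside the full semigroup ring\<close>

lemma carrier_SB_subset: "carrier SB \<subseteq> carrier SA"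
  by (auto simp: carrier_SA carrier_SB)

lemma semigroup_ring_SB_subset: "f \<in> carrier B.RS \<Longrightarrow> f \<in> carrier A.RS"
  using carrier_SB_subset by (auto simp: A.semigroup_ring_carrier B.semigroup_ring_carrier)

text \<open>Both rings consist of functions on the same type, and their operations see the semigroup
  only through the common \<open>slice_mult\<close>. The inclusion is therefore the identity on
  functions.\<close>

lemma semigroup_ring_SB_ops: "x \<oplus>\<^bsub>B.RS\<^esub> y = x \<oplus>\<^bsub>A.RS\<^esub> y" "x \<otimes>\<^bsub>B.RS\<^esub> y = x \<otimes>\<^bsub>A.RS\<^esub> y"
  by (simp_all add: semigroup_ring_def A.smul_eq B.smul_eq)

lemma pA_hom_SB: "nonassoc_rng_hom B.RS QA pA"
proof -
  have "pA \<in> rng_hom B.RS QA"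
    by (auto simp: rng_hom_def semigroup_ring_SB_ops semigroup_ring_SB_subset)
  then show ?thesis
    by (simp add: nonassoc_rng_hom_def nonassoc_rng_hom_axioms_def
        B.RS.nonassoc_rng_axioms pA.B.nonassoc_rng_axioms)
qed

lemma pA_Un:
  assumes "r \<in> carrier R" "X \<in> compact_slices G T" "Y \<in> compact_slices G T"
    "X \<union> Y \<in> compact_slices G T" "X \<inter> Y = {}"
  shows "pA (monomial R r (X \<union> Y)) = pA (monomial R r X) \<oplus>\<^bsub>QA\<^esub> pA (monomial R r Y)"
  using assms by (intro A.enveloping_map_Un[OF _ _ _ _ \<Gamma>.one_closed]) (auto simp: carrier_SA scomponent_SA)

text \<open>The ungraded join relation places no condition on degrees, so the parts of
  \<open>X\<close> can be split off one at a time, by induction on the set of degrees.\<close>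

lemma pA_monomial_eq_homogeneous:
  assumes r: "r \<in> carrier R" and X: "X \<in> compact_slices G T"
  shows "\<exists>b \<in> carrier B.RS. pA b = pA (monomial R r X)"
proof -
  have *: "\<exists>b \<in> carrier B.RS. pA b = pA (monomial R r (\<Union>\<alpha>\<in>D. X \<inter> hcomp \<alpha>))" if "finite D" for D
    using that
  proof (induction D rule: finite_induct)
    case empty
    then show ?case
      using B.monomial_closed[OF r B.empty_closed] by auto
  next
    case (insert \<beta> D)
    then obtain b where b: "b \<in> carrier B.RS" "pA b = pA (monomial R r (\<Union>\<alpha>\<in>D. X \<inter> hcomp \<alpha>))"
      by blast
    have D: "(\<Union>\<alpha>\<in>E. X \<inter> hcomp \<alpha>) \<in> compact_slices G T" if "finite E" for E
      by (rule Union_compact_slice[OF that _ _ X]) (use compact_slice_Int_hcomp[OF X] in auto)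
    have m: "monomial R r (X \<inter> hcomp \<beta>) \<in> carrier B.RS"
      by (rule B.monomial_closed[OF r Int_hcomp_closed[OF X]])
    have "(X \<inter> hcomp \<beta>) \<inter> (\<Union>\<alpha>\<in>D. X \<inter> hcomp \<alpha>) = {}"
      using insert.hyps by (auto simp: gcomponent_def)
    then have "pA (monomial R r (\<Union>\<alpha>\<in>insert \<beta> D. X \<inter> hcomp \<alpha>)) =
        pA (monomial R r (X \<inter> hcomp \<beta>)) \<oplus>\<^bsub>QA\<^esub> pA (monomial R r (\<Union>\<alpha>\<in>D. X \<inter> hcomp \<alpha>))"
      using pA_Un[OF r compact_slice_Int_hcomp[OF X] D[OF insert.hyps(1)]] D[of "insert \<beta> D"] insert.hyps(1)
      by simp
    also have "\<dots> = pA (monomial R r (X \<inter> hcomp \<beta>) \<oplus>\<^bsub>A.RS\<^esub> b)"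
      using b m by (simp add: semigroup_ring_SB_subset)
    finally show ?case
      using b m B.semigroup_ring_add_closed[OF m b(1)] unfolding semigroup_ring_SB_ops by metis
  qed
  show ?thesis
    using *[OF finite_deg_image[OF X]] compact_slice_eq_UNION_hcomp(1)[OF X] by simp
qed

text \<open>Surjectivity of the map induced by the inclusion of homogeneous slices, stated for
  representatives.\<close>

lemma pA_image_SB:
  assumes "a \<in> carrier A.RS"
  shows "\<exists>b \<in> carrier B.RS. pA b = pA a"
  using assms
proof (induction rule: A.semigroup_ring_induct)
  case zero
  have "\<zero>\<^bsub>B.RS\<^esub> = \<zero>\<^bsub>A.RS\<^esub>"
    by (simp add: semigroup_ring_def)
  then show ?case
    using B.RS.zero_closed by metis
next
  case (monomial r s)
  then show ?case
    using pA_monomial_eq_homogeneous by (simp add: carrier_SA)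
next
  case (add f g)
  then obtain b c where "b \<in> carrier B.RS" "pA b = pA f" "c \<in> carrier B.RS" "pA c = pA g"
    by blast
  then show ?case
    using add.hyps B.semigroup_ring_add_closed[of b c] unfolding semigroup_ring_SB_ops
    by (intro bexI[of _ "b \<oplus>\<^bsub>A.RS\<^esub> c"]) (auto simp: semigroup_ring_SB_subset)
qed

theorem enveloping_rings_isomorphic: "is_rng_iso QA QB"
proof -
  obtain h where h: "nonassoc_rng_hom A.RS QB h"
    and h_mon: "\<And>r X. r \<in> carrier R \<Longrightarrow> X \<in> carrier SA \<Longrightarrow> h (monomial R r X) = homogeneous_sum r X"
    by (rule A.linear_extension[OF pB.B.nonassoc_rng_axioms, of homogeneous_sum])
      (auto simp: carrier_SA A.smul_eq homogeneous_sum_closed homogeneous_sum_add homogeneous_sum_mult)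
  interpret h: nonassoc_rng_hom A.RS QB h by fact
  \<comment> \<open>Both maps are additive, and on a homogeneous monomial the sum of parts has a
    single term.\<close>
  have h_SB: "h b = pB b" if "b \<in> carrier B.RS" for b
    using that
  proof (induction rule: B.semigroup_ring_induct)
    case zero
    have "\<zero>\<^bsub>B.RS\<^esub> = \<zero>\<^bsub>A.RS\<^esub>"
      by (simp add: semigroup_ring_def)
    then show ?case
      using h.hom_zero pB.hom_zero by metis
  next
    case (monomial r X)
    then show ?case
      using h_mon homogeneous_sum_homogeneous carrier_SB_subset by auto
  next
    case (add f g)
    have "h (f \<oplus>\<^bsub>B.RS\<^esub> g) = h f \<oplus>\<^bsub>QB\<^esub> h g"
      unfolding semigroup_ring_SB_ops using add.hyps by (simp add: semigroup_ring_SB_subset)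
    then show ?case
      using add by simp
  qed
  \<comment> \<open>Every ungraded join relation is a disjoint union, on which
    \<open>homogeneous_sum\<close> is additive.\<close>
  have pA_h: "h a = \<zero>\<^bsub>QB\<^esub>" if "a \<in> carrier A.RS" "pA a = \<zero>\<^bsub>QA\<^esub>" for a
  proof (rule A.enveloping_map_universal[OF h _ _ that])
    show "h (basis_elem R (szero SA)) = \<zero>\<^bsub>QB\<^esub>"
      using h_mon[OF R.one_closed A.empty_closed]
      by (simp add: basis_elem_eq_monomial A.szero_eq homogeneous_sum_def)
    show "h (basis_elem R u) \<oplus>\<^bsub>QB\<^esub> h (basis_elem R v) = h (basis_elem R w)"
      if "join_triple SA \<Gamma> (\<lambda>_. \<one>\<^bsub>\<Gamma>\<^esub>) u v w" for u v w
      using join_triple_SA[OF that] homogeneous_sum_Un[of \<one> u v]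
      by (simp add: basis_elem_eq_monomial h_mon carrier_SA)
  qed
  have pB_pA: "pA b = \<zero>\<^bsub>QA\<^esub>" if "b \<in> carrier B.RS" "pB b = \<zero>\<^bsub>QB\<^esub>" for b
  proof (rule B.enveloping_map_universal[OF pA_hom_SB _ _ that])
    show "pA (basis_elem R (szero SB)) = \<zero>\<^bsub>QA\<^esub>"
      using A.enveloping_map_empty[of \<one>] by (simp add: basis_elem_eq_monomial B.szero_eq)
    show "pA (basis_elem R u) \<oplus>\<^bsub>QA\<^esub> pA (basis_elem R v) = pA (basis_elem R w)"
      if "join_triple SB \<Gamma> (slice_degree G \<Gamma> deg) u v w" for u v w
      by (rule A.enveloping_map_join[OF join_triple_SB[OF that]])
  qed
  show ?thesis
  proof (rule is_rng_isoI[OF pA.nonassoc_rng_hom_axioms A.enveloping_map_surj h])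
    \<comment> \<open>The homogeneous elements alone already cover \<open>QB\<close>, because
      \<open>h\<close> is \<open>pB\<close> there.\<close>
    have "carrier QB = h ` carrier B.RS"
      using h_SB B.enveloping_map_surj by (metis (no_types, lifting) image_cong)
    then show "h ` carrier A.RS = carrier QB"
      using semigroup_ring_SB_subset h.hom_closed by blast
    show "pA a = \<zero>\<^bsub>QA\<^esub> \<longleftrightarrow> h a = \<zero>\<^bsub>QB\<^esub>" if a: "a \<in> carrier A.RS" for a
    proof
      assume ha: "h a = \<zero>\<^bsub>QB\<^esub>"
      obtain b where b: "b \<in> carrier B.RS" "pA b = pA a"
        using pA_image_SB[OF a] by blast
      \<comment> \<open>By the inclusion already known, \<open>h\<close> also kills this difference.
        So \<open>pB b = h b = h a\<close> vanishes, and the relations of \<open>QB\<close> hold in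
        \<open>QA\<close>.\<close>
      then have "pA (b \<ominus>\<^bsub>A.RS\<^esub> a) = \<zero>\<^bsub>QA\<^esub>"
        using a by (simp add: pA.hom_minus semigroup_ring_SB_subset pA.B.minus_eq_zero_iff)
      then have "h b = h a"
        using pA_h[of "b \<ominus>\<^bsub>A.RS\<^esub> a"] a b
        by (simp add: h.hom_minus semigroup_ring_SB_subset pB.B.minus_eq_zero_iff)
      then have "pB b = \<zero>\<^bsub>QB\<^esub>"
        using ha h_SB b by simp
      then show "pA a = \<zero>\<^bsub>QA\<^esub>"
        using pB_pA b by metis
    qed (use pA_h a in blast)
  qed
qed

end

theorem theorem6p1:
  fixes R :: "('r, 'm) ring_scheme"
    and \<Gamma> :: "('a, 'n) monoid_scheme"
    and G :: "('g, 'x) groupoid_scheme"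
    and T :: "'g topology"
    and deg :: "'g \<Rightarrow> 'a"
  assumes "ring R"
    and "group \<Gamma>"
    and "ample_groupoid G T"
    and "Hausdorff_space T"
    and "is_grading G T \<Gamma> deg"
  shows "is_rng_iso
    (enveloping_ring R (slice_semigroup G T) \<Gamma> (\<lambda>_. \<one>\<^bsub>\<Gamma>\<^esub>))
    (enveloping_ring R (graded_slice_semigroup G T \<Gamma> deg) \<Gamma> (slice_degree G \<Gamma> deg))"
proof -
  interpret graded_etale_groupoid R \<Gamma> G T deg
    using assms ample_groupoid.axioms(1)[of G T]
    by (simp add: graded_etale_groupoid_def graded_etale_groupoid_axioms_def)
  show ?thesis
    by (rule enveloping_rings_isomorphic)
qed

end
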